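(* Let $\alpha\in(0,0.3738)$ and $\beta\in(1,2)$. If the temporal stepsize $\tau$ and the spatial stepsize $h$ are sufficiently small, then the fully discrete L1-2 scheme in the context is numerically stable, and its solution satisfies $$\|U^n\|_h\le\|U^0\|_h+C^{(\alpha)}\max_{1\le k\le n}\big\{(k\tau)^{\alpha}\|f^k\|_h\big\},\qquad 1\le n\le N,$$ with $C^{(\alpha)}=\max\Big\{\frac{6\Gamma(1-\alpha)}{\tilde a^{\alpha}},\frac{3\Gamma(2-\alpha)}{\alpha\tilde a^{\alpha}}\Big\}$.
   Context: Time grid: $\tilde a>0$, $T>\tilde a$, $N\in\mathbb{Z}^+$, $\tau=(T-\tilde a)/N$, $t_k=\tilde a+k\tau$. L1-2 coefficients: $a^{(\alpha)}_{i,k}=(\log\frac{t_k}{t_{i-1}})^{1-\alpha}-(\log\frac{t_k}{t_i})^{1-\alpha}$; for $i\ge2$, $b^{(\alpha)}_{i,k}=\frac{1}{\log\frac{t_i}{t_{i-2}}}\{\log\frac{t_i}{t_{i-1}}[(\log\frac{t_k}{t_i})^{1-\alpha}+(\log\frac{t_k}{t_{i-1}})^{1-\alpha}]+\frac{2}{2-\alpha}[(\log\frac{t_k}{t_i})^{2-\alpha}-(\log\frac{t_k}{t_{i-1}})^{2-\alpha}]\}$; $c^{(\alpha)}_{1,1}=\frac{a^{(\alpha)}_{1,1}}{\Gamma(2-\alpha)\log\frac{t_1}{t_0}}$; for $k\ge2$: $c^{(\alpha)}_{1,k}=\frac{a^{(\alpha)}_{1,k}+b^{(\alpha)}_{2,k}}{\Gamma(2-\alpha)\log\frac{t_1}{t_0}}$,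 $c^{(\alpha)}_{i,k}=\frac{a^{(\alpha)}_{i,k}-b^{(\alpha)}_{i,k}+b^{(\alpha)}_{i+1,k}}{\Gamma(2-\alpha)\log\frac{t_i}{t_{i-1}}}$ ($2\le i\le k-1$), $c^{(\alpha)}_{k,k}=\frac{a^{(\alpha)}_{k,k}-b^{(\alpha)}_{k,k}}{\Gamma(2-\alpha)\log\frac{t_k}{t_{k-1}}}$. Space grid: $a<b$, $M\in\mathbb{Z}^+$, $h=(b-a)/M$, $x_j=a+jh$; $\|w\|_h^2=h\sum_{j=1}^{M-1}w_j^2$. Riesz coefficients: $g^{(\beta)}_k=(-1)^k\binom{\beta}{k}$, $\Psi_\beta=\frac{1}{2\cos(\pi\beta/2)}$, $r^{(\beta)}_0=2\Psi_\beta(\frac{\beta}{2}g^{(\beta)}_1+\frac{2-\beta}{2}g^{(\beta)}_0)$, $r^{(\beta)}_1=\Psi_\beta(\frac{\beta}{2}g^{(\beta)}_0+\frac{2-\beta}{2}g^{(\beta)}_1+\frac{\beta}{2}g^{(\beta)}_2)$, $r^{(\beta)}_k=\Psi_\beta(\frac{\beta}{2}g^{(\beta)}_{k+1}+\frac{2-\beta}{2}g^{(\beta)}_k)$ ($k\ge2$), $r^{(\beta)}_{-k}=r^{(\beta)}_k$. Scheme (with $f^n_j=f(x_j,t_n)$, $f^n=(f^n_j)_j$): $c^{(\alpha)}_{1,1}U^1_j-c^{(\alpha)}_{1,1}U^0_j+h^{-\beta}\sum_{k=0}^Mr^{(\beta)}_{j-k}U^1_k=f^1_j$; for $2\le n\le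 N$: $c^{(\alpha)}_{n,n}U^n_j+\sum_{i=1}^{n-1}(c^{(\alpha)}_{i,n}-c^{(\alpha)}_{i+1,n})U^i_j-c^{(\alpha)}_{1,n}U^0_j+h^{-\beta}\sum_{k=0}^Mr^{(\beta)}_{j-k}U^n_k=f^n_j$; for $1\le j\le M-1$; $U^0_j=u_0(x_j)$; $U^n_0=U^n_M=0$. *)

theory Defs
  imports "HOL-Analysis.Analysis"
begin

definition tgrid :: "real \<Rightarrow> real \<Rightarrow> nat \<Rightarrow> nat \<Rightarrow> real" where
  "tgrid a0 T N \<equiv> (\<lambda>k. a0 + real k * ((T - a0) / real N))"

definition L12_a :: "real \<Rightarrow> (nat \<Rightarrow> real) \<Rightarrow> nat \<Rightarrow> nat \<Rightarrow> real" where
  "L12_a \<alpha> t i k = ln (t k / t (i - 1)) powr (1 - \<alpha>) - ln (t k / t i) powr (1 - \<alpha>)"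

definition L12_b :: "real \<Rightarrow> (nat \<Rightarrow> real) \<Rightarrow> nat \<Rightarrow> nat \<Rightarrow> real" where
  "L12_b \<alpha> t i k = (1 / ln (t i / t (i - 2))) *
     (ln (t i / t (i - 1)) * (ln (t k / t i) powr (1 - \<alpha>) + ln (t k / t (i - 1)) powr (1 - \<alpha>))
      + 2 / (2 - \<alpha>) * (ln (t k / t i) powr (2 - \<alpha>) - ln (t k / t (i - 1)) powr (2 - \<alpha>)))"

definition L12_c :: "real \<Rightarrow> (nat \<Rightarrow> real) \<Rightarrow> nat \<Rightarrow> nat \<Rightarrow> real" where
  "L12_c \<alpha> t i k =
    (if k = 1 then L12_a \<alpha> t 1 1 / (Gamma (2 - \<alpha>) * ln (t 1 / t 0))
     else if i = 1 then (L12_a \<alpha> t 1 k + L12_b \<alpha> t 2 k) / (Gamma (2 - \<alpha>) * ln (t 1 / t 0))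
     else if i < k then (L12_a \<alpha> t i k - L12_b \<alpha> t i k + L12_b \<alpha> t (i + 1) k)
                          / (Gamma (2 - \<alpha>) * ln (t i / t (i - 1)))
     else (L12_a \<alpha> t k k - L12_b \<alpha> t k k) / (Gamma (2 - \<alpha>) * ln (t k / t (k - 1))))"

definition riesz_g :: "real \<Rightarrow> nat \<Rightarrow> real" where
  "riesz_g \<beta> k = (-1) ^ k * (\<beta> gchoose k)"

definition riesz_Psi :: "real \<Rightarrow> real" where
  "riesz_Psi \<beta> = 1 / (2 * cos (pi * \<beta> / 2))"

definition riesz_r_nat :: "real \<Rightarrow> nat \<Rightarrow> real" where
  "riesz_r_nat \<beta> k =
    (if k = 0 then 2 * riesz_Psi \<beta> * (\<beta> / 2 * riesz_g \<beta> 1 + (2 - \<beta>) / 2 * riesz_g \<beta> 0)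
     else if k = 1 then riesz_Psi \<beta> * (\<beta> / 2 * riesz_g \<beta> 0 + (2 - \<beta>) / 2 * riesz_g \<beta> 1
                                       + \<beta> / 2 * riesz_g \<beta> 2)
     else riesz_Psi \<beta> * (\<beta> / 2 * riesz_g \<beta> (k + 1) + (2 - \<beta>) / 2 * riesz_g \<beta> k))"

definition riesz_r :: "real \<Rightarrow> int \<Rightarrow> real" where
  "riesz_r \<beta> k = riesz_r_nat \<beta> (nat \<bar>k\<bar>)"

definition hnorm :: "real \<Rightarrow> nat \<Rightarrow> (nat \<Rightarrow> real) \<Rightarrow> real" where
  "hnorm h M w = sqrt (h * (\<Sum>j = 1..M - 1. (w j)\<^sup>2))"

text \<open>The fully discrete L1-2 scheme: U n j approximates u(x_j, t_n).
  Parameters: alpha, beta, a~, T, N, a, b, M, initial datum u0, source f, solution U.\<close>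
definition L12_scheme ::
  "real \<Rightarrow> real \<Rightarrow> real \<Rightarrow> real \<Rightarrow> nat \<Rightarrow> real \<Rightarrow> real \<Rightarrow> nat
   \<Rightarrow> (real \<Rightarrow> real) \<Rightarrow> (real \<Rightarrow> real \<Rightarrow> real) \<Rightarrow> (nat \<Rightarrow> nat \<Rightarrow> real) \<Rightarrow> bool" where
  "L12_scheme \<alpha> \<beta> a0 T N a b M u0 f U \<longleftrightarrow>
    (let t = tgrid a0 T N; h = (b - a) / real M; x = (\<lambda>j. a + real j * h);
         A = (\<lambda>n j. h powr (-\<beta>) * (\<Sum>k = 0..M. riesz_r \<beta> (int j - int k) * U n k)) in
     (\<forall>j \<le> M. U 0 j = u0 (x j)) \<and>
     (\<forall>n. 1 \<le> n \<and> n \<le> N \<longrightarrow> U n 0 = 0 \<and> U n M = 0) \<and>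
     (\<forall>j. 1 \<le> j \<and> j \<le> M - 1 \<longrightarrow>
        L12_c \<alpha> t 1 1 * U 1 j - L12_c \<alpha> t 1 1 * U 0 j + A 1 j = f (x j) (t 1)) \<and>
     (\<forall>n j. 2 \<le> n \<and> n \<le> N \<and> 1 \<le> j \<and> j \<le> M - 1 \<longrightarrow>
        L12_c \<alpha> t n n * U n j
        + (\<Sum>i = 1..n - 1. (L12_c \<alpha> t i n - L12_c \<alpha> t (i + 1) n) * U i j)
        - L12_c \<alpha> t 1 n * U 0 j + A n j = f (x j) (t n)))"

end

theory Submission
  imports Defs
begin

text \<open>
  Write \<open>x\<^sub>i = ln (t\<^sub>k / t\<^sub>i)\<close>. Up to the factor \<open>\<Gamma>(2 - \<alpha>)\<close>, the coefficient \<open>c\<^sub>i\<^sub>,\<^sub>k\<close> is the difference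
  quotient of \<open>z powr (1 - \<alpha>)\<close> over \<open>[x\<^sub>i, x\<^sub>i\<^sub>-\<^sub>1]\<close> plus a correction built from trapezoidal errors.
  If the \<open>c\<^sub>i\<^sub>,\<^sub>k\<close> are positive and nondecreasing in \<open>i\<close>, testing the scheme with \<open>U\<^sup>n\<close> (the Riesz
  matrix is diagonally dominant, hence positive semidefinite) and induction on \<open>n\<close> give the bound with
  \<open>1 / c\<^sub>1\<^sub>,\<^sub>k\<close> as the weight of \<open>f\<^sup>k\<close>.

  For small \<open>\<tau>\<close> the steps \<open>x\<^sub>i\<^sub>-\<^sub>1 - x\<^sub>i\<close> decrease in \<open>i\<close> with ratios uniformly close to 1. Away from the
  singularity at \<open>x\<^sub>k = 0\<close> the corrections are crudely dominated by the difference of the quotients.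
  The only delicate comparison is \<open>c\<^sub>k\<^sub>-\<^sub>2\<^sub>,\<^sub>k \<le> c\<^sub>k\<^sub>-\<^sub>1\<^sub>,\<^sub>k\<close>. By scaling and continuity it reduces to the
  uniform mesh, where it reads
  \<open>(3p + 15) 2\<^sup>p - (p + 7) 3\<^sup>p - 3p - 9 > 0\<close> for \<open>p = 1 - \<alpha>\<close>. The left-hand side is concave, vanishes at
  \<open>p = 1\<close> and is just positive at \<open>p = 0.6262\<close>: this is the origin of the threshold 0.3738.
\<close>

section \<open>Positivity of the Riesz matrix\<close>

text \<open>Term n + 1 is term n times (n - \<beta>) / (n + 1), a nonnegative factor for n \<ge> 1,
  so all terms keep the sign of the first one, -\<beta>.\<close>

lemma alternating_gchoose_nonpos:
  fixes \<beta> :: real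
  assumes "0 < \<beta>" "\<beta> < 1" "1 \<le> n"
  shows "(-1) ^ n * (\<beta> gchoose n) \<le> 0"
  using assms(3)
proof (induction n rule: dec_induct)
  case base then show ?case using assms by simp
next
  case (step n)
  have "(-1) ^ Suc n * (\<beta> gchoose Suc n) = ((-1) ^ n * (\<beta> gchoose n)) * ((real n - \<beta>) / (real n + 1))"
    by (simp add: gbinomial_prod_rev field_simps)
  also have "\<dots> \<le> 0" using step.IH step.hyps assms by (intro mult_nonpos_nonneg[OF step.IH]) auto
  finally show ?case .
qed

text \<open>Absorption lowers the exponent to \<beta> - 1 in (0, 1), where alternating coefficients
  are nonpositive; the index shift supplies a second minus sign.\<close>

lemma riesz_g_nonneg:
  assumes "1 < \<beta>" "\<beta> < 2" "2 \<le> k"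
  shows "0 \<le> riesz_g \<beta> k"
proof -
  have "\<beta> gchoose k = \<beta> / real k * ((\<beta> - 1) gchoose (k - 1))"
    using gbinomial_absorption[of "k - 1" \<beta>] assms by (simp add: field_simps)
  moreover have "(-1::real) ^ k = - ((-1) ^ (k - 1))"
    using assms by (cases k) auto
  ultimately have "riesz_g \<beta> k = - (\<beta> / real k) * ((-1) ^ (k - 1) * ((\<beta> - 1) gchoose (k - 1)))"
    by (simp add: riesz_g_def)
  moreover have "(-1) ^ (k - 1) * ((\<beta> - 1) gchoose (k - 1)) \<le> 0"
    using assms by (intro alternating_gchoose_nonpos) auto
  moreover have "- (\<beta> / real k) \<le> 0" using assms by simp
  ultimately show ?thesis by (simp only: mult_nonpos_nonpos)
qed

lemma riesz_Psi_neg: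
  assumes "1 < \<beta>" "\<beta> < 2"
  shows "riesz_Psi \<beta> < 0"
proof -
  have "0 < cos (pi * \<beta> / 2 - pi)"
    using assms by (intro cos_gt_zero_pi) (auto simp: field_simps)
  then have "cos (pi * \<beta> / 2) < 0" by simp
  then show ?thesis by (simp add: riesz_Psi_def divide_less_0_iff)
qed

text \<open>The off-diagonal sign. For k \<ge> 2 only nonnegative g enter. The case k = 1 is
  separate because it contains g_1 = -\<beta>, which g_0 and g_2 outweigh, as the factorisation
  shows.\<close>

lemma riesz_r_nat_nonpos:
  assumes "1 < \<beta>" "\<beta> < 2" "1 \<le> k"
  shows "riesz_r_nat \<beta> k \<le> 0"
proof (cases "k = 1")
  case True
  have "riesz_r_nat \<beta> 1 = riesz_Psi \<beta> * (\<beta> * (\<beta> - 1) * (\<beta> + 2) / 4)"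
    by (simp add: riesz_r_nat_def riesz_g_def gbinomial_prod_rev numeral_2_eq_2 field_simps)
  also have "\<dots> \<le> 0" using assms riesz_Psi_neg[OF assms(1,2)]
    by (intro mult_nonpos_nonneg) auto
  finally show ?thesis using True by simp
next
  case False
  then show ?thesis using assms riesz_Psi_neg[OF assms(1,2)]
      riesz_g_nonneg[OF assms(1,2), of k] riesz_g_nonneg[OF assms(1,2), of "k+1"]
    by (auto simp: riesz_r_nat_def intro!: mult_nonpos_nonneg add_nonneg_nonneg)
qed

lemma riesz_g_partial_sum: "(\<Sum>k\<le>n. riesz_g \<beta> k) = (-1) ^ n * ((\<beta> - 1) gchoose n)"
  using gbinomial_sum_lower_neg[of \<beta> n] by (simp add: riesz_g_def mult.commute)

text \<open>The entries of a row in the symmetric window of radius n collect into two partial sums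
  of g with weights \<beta> and 2 - \<beta>; \<open>riesz_g_partial_sum\<close> gives these in
  closed form.\<close>

lemma riesz_r_partial_sum:
  assumes "1 \<le> n"
  shows "riesz_r_nat \<beta> 0 + 2 * (\<Sum>k=1..n. riesz_r_nat \<beta> k)
    = riesz_Psi \<beta> * (\<beta> * (\<Sum>k\<le>n+1. riesz_g \<beta> k) + (2 - \<beta>) * (\<Sum>k\<le>n. riesz_g \<beta> k))"
  using assms
proof (induction n rule: dec_induct)
  case base then show ?case by (simp add: riesz_r_nat_def numeral_2_eq_2 field_simps)
next
  case (step n)
  then have "riesz_r_nat \<beta> (Suc n) = riesz_Psi \<beta> * (\<beta> / 2 * riesz_g \<beta> (Suc n + 1) + (2 - \<beta>) / 2 * riesz_g \<beta> (Suc n))"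
    by (simp add: riesz_r_nat_def)
  then show ?case using step.IH by (simp add: field_simps)
qed

text \<open>Partial sums of g are alternating binomials of exponent \<beta> - 1, nonpositive from
  order 1 on, and \<open>riesz_Psi\<close> is negative. Radius 0 is separate because there the
  partial sum g_0 = 1 is positive.\<close>

lemma riesz_r_partial_sum_nonneg:
  assumes "1 < \<beta>" "\<beta> < 2"
  shows "0 \<le> riesz_r_nat \<beta> 0 + 2 * (\<Sum>k=1..n. riesz_r_nat \<beta> k)"
proof (cases "n = 0")
  case True
  have "riesz_r_nat \<beta> 0 = - riesz_Psi \<beta> * ((\<beta> - 1) * (\<beta> + 2))"
    by (simp add: riesz_r_nat_def riesz_g_def field_simps)
  then show ?thesis using assms riesz_Psi_neg[OF assms] True by (simp add: mult_nonpos_nonneg)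
next
  case False
  have "(\<Sum>k\<le>m. riesz_g \<beta> k) \<le> 0" if "1 \<le> m" for m
    unfolding riesz_g_partial_sum using assms that by (intro alternating_gchoose_nonpos) auto
  from this[of n] this[of "n + 1"] have "\<beta> * (\<Sum>k\<le>n+1. riesz_g \<beta> k) + (2 - \<beta>) * (\<Sum>k\<le>n. riesz_g \<beta> k) \<le> 0"
    using assms False by (intro add_nonpos_nonpos mult_nonneg_nonpos) auto
  then show ?thesis using riesz_r_partial_sum[of n \<beta>] riesz_Psi_neg[OF assms] False
    by (simp add: mult_nonpos_nonpos)
qed

text \<open>The off-diagonal entries are nonpositive and every row sum is nonnegative, so the
  quadratic form dominates its value with each product replaced by the mean of the squares.\<close>
lemma riesz_psd:
  assumes "1 < \<beta>" "\<beta> < 2"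
  shows "0 \<le> (\<Sum>j=0..M. \<Sum>k=0..M. riesz_r \<beta> (int j - int k) * v k * v j)"
proof -
  let ?r = "\<lambda>j k. riesz_r \<beta> (int j - int k)"
  have sym: "?r j k = ?r k j" for j k by (simp add: riesz_r_def abs_minus_commute)
  have le: "?r j k * ((v j)\<^sup>2 + (v k)\<^sup>2) / 2 \<le> ?r j k * v k * v j" for j k
  proof (cases "j = k")
    case True then show ?thesis by (simp add: power2_eq_square)
  next
    case False
    have "?r j k \<le> 0" unfolding riesz_r_def using False assms by (intro riesz_r_nat_nonpos) auto
    moreover have "v k * v j \<le> ((v j)\<^sup>2 + (v k)\<^sup>2) / 2" using sum_squares_bound[of "v k" "v j"] by simp
    ultimately show ?thesis by (metis (no_types, opaque_lifting) mult.assoc mult_left_mono_neg times_divide_eq_right)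
  qed
  have row: "0 \<le> (\<Sum>k=0..M. ?r j k)" if "j \<le> M" for j
  proof -
    have "(\<Sum>k=0..M. ?r j k) = (\<Sum>k\<in>{0..<j} \<union> {j} \<union> {j<..M}. ?r j k)"
      using that by (intro sum.cong) auto
    also have "\<dots> = (\<Sum>k\<in>{0..<j}. ?r j k) + ?r j j + (\<Sum>k\<in>{j<..M}. ?r j k)"
      by (subst sum.union_disjoint; (subst sum.union_disjoint)?) auto
    also have "(\<Sum>k\<in>{0..<j}. ?r j k) = (\<Sum>k=1..j. riesz_r_nat \<beta> k)"
      by (rule sum.reindex_bij_witness[of _ "\<lambda>k. j - k" "\<lambda>k. j - k"]) (auto simp: riesz_r_def nat_diff_distrib)
    also have "(\<Sum>k\<in>{j<..M}. ?r j k) = (\<Sum>k=1..M-j. riesz_r_nat \<beta> k)"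
      by (rule sum.reindex_bij_witness[of _ "\<lambda>k. k + j" "\<lambda>k. k - j"]) (auto simp: riesz_r_def nat_diff_distrib)
    \<comment> \<open>Doubling turns the two half rows into symmetric windows of radii j and M - j,
      each with its own copy of the diagonal entry.\<close>
    finally have "2 * (\<Sum>k=0..M. ?r j k) = (riesz_r_nat \<beta> 0 + 2 * (\<Sum>k=1..j. riesz_r_nat \<beta> k))
       + (riesz_r_nat \<beta> 0 + 2 * (\<Sum>k=1..M-j. riesz_r_nat \<beta> k))"
      by (simp add: riesz_r_def)
    then show ?thesis
      using riesz_r_partial_sum_nonneg[OF assms, of j] riesz_r_partial_sum_nonneg[OF assms, of "M - j"] by linarith
  qed
  have swap: "(\<Sum>j=0..M. \<Sum>k=0..M. ?r j k * (v k)\<^sup>2) = (\<Sum>j=0..M. \<Sum>k=0..M. ?r j k * (v j)\<^sup>2)"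
    by (subst sum.swap) (simp add: sym)
  have "0 \<le> (\<Sum>j=0..M. (v j)\<^sup>2 * (\<Sum>k=0..M. ?r j k))"
    by (rule sum_nonneg, rule mult_nonneg_nonneg) (auto intro: row)
  also have "\<dots> = (\<Sum>j=0..M. \<Sum>k=0..M. ?r j k * (v j)\<^sup>2)"
    by (simp add: sum_distrib_left mult.commute)
  also have "\<dots> = (\<Sum>j=0..M. \<Sum>k=0..M. ?r j k * ((v j)\<^sup>2 + (v k)\<^sup>2) / 2)"
    by (simp add: distrib_left add_divide_distrib sum.distrib swap flip: sum_divide_distrib)
  also have "\<dots> \<le> (\<Sum>j=0..M. \<Sum>k=0..M. ?r j k * v k * v j)"
    by (intro sum_mono le)
  finally show ?thesis .
qed

section \<open>Taylor estimates for the power function\<close>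

text \<open>Lagrange remainder about y with no order fixed between u and y, so that it serves
  expansions about either end of a cell.\<close>

lemma powr_taylor2:
  fixes u y \<alpha> :: real
  assumes "0 < u" "0 < y" "u \<noteq> y"
  obtains \<xi> where "min u y < \<xi>" "\<xi> < max u y"
    "u powr (1 - \<alpha>) = y powr (1 - \<alpha>) + (1 - \<alpha>) * y powr (-\<alpha>) * (u - y)
       - (1 - \<alpha>) * \<alpha> / 2 * \<xi> powr (-\<alpha> - 1) * (u - y)\<^sup>2"
proof -
  define D where "D = (\<lambda>(m::nat) (z::real). if m = 0 then z powr (1 - \<alpha>)
     else if m = 1 then (1 - \<alpha>) * z powr (-\<alpha>) else (1 - \<alpha>) * (-\<alpha>) * z powr (-\<alpha> - 1))"
  have der: "\<forall>m t. m < 2 \<and> min u y \<le> t \<and> t \<le> max u y \<longrightarrow> (D m has_real_derivative D (Suc m) t) (at t)"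
  proof (intro allI impI)
    fix m t assume A: "m < (2::nat) \<and> min u y \<le> t \<and> t \<le> max u y"
    then have t: "0 < t" using assms by (auto simp: min_def split: if_splits)
    consider "m = 0" | "m = 1" using A by linarith
    then show "(D m has_real_derivative D (Suc m) t) (at t)"
    proof cases
      case 1 then show ?thesis using t unfolding D_def
        by (auto intro!: derivative_eq_intros)
    next
      case 2 then show ?thesis using t unfolding D_def
        by (auto intro!: derivative_eq_intros simp: algebra_simps)
    qed
  qed
  have "\<exists>t. (if u < y then u < t \<and> t < y else y < t \<and> t < u) \<and>
    D 0 u = (\<Sum>m<2. D m y / fact m * (u - y) ^ m) + D 2 t / fact 2 * (u - y) ^ 2"
    by (rule Taylor[where a = "min u y" and b = "max u y"]) (use der assms in \<open>auto simp: D_def\<close>)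
  then obtain t where t: "if u < y then u < t \<and> t < y else y < t \<and> t < u"
    "D 0 u = (\<Sum>m<2. D m y / fact m * (u - y) ^ m) + D 2 t / fact 2 * (u - y) ^ 2" by blast
  show ?thesis
  proof (rule that[of t])
    show "min u y < t" "t < max u y" using t(1) assms by (auto simp: min_def max_def split: if_splits)
    show "u powr (1 - \<alpha>) = y powr (1 - \<alpha>) + (1 - \<alpha>) * y powr (-\<alpha>) * (u - y)
       - (1 - \<alpha>) * \<alpha> / 2 * t powr (-\<alpha> - 1) * (u - y)\<^sup>2"
      using t(2) unfolding D_def by (simp add: numeral_2_eq_2)
  qed
qed

text \<open>Expansion about the right end. The middle quantity is twice the derivative of
  \<open>trap_defect\<close> in y, which is why both bounds are kept.\<close>

lemma powr_taylor2_left: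
  fixes x y \<alpha> :: real
  assumes "0 < x" "x \<le> y" "0 \<le> \<alpha>" "\<alpha> \<le> 1"
  shows "(1 - \<alpha>) * \<alpha> / 2 * y powr (-\<alpha> - 1) * (y - x)\<^sup>2
           \<le> y powr (1 - \<alpha>) - x powr (1 - \<alpha>) - (1 - \<alpha>) * y powr (-\<alpha>) * (y - x)"
    and "y powr (1 - \<alpha>) - x powr (1 - \<alpha>) - (1 - \<alpha>) * y powr (-\<alpha>) * (y - x)
           \<le> (1 - \<alpha>) * \<alpha> / 2 * x powr (-\<alpha> - 1) * (y - x)\<^sup>2"
proof -
  have "(1 - \<alpha>) * \<alpha> / 2 * y powr (-\<alpha> - 1) * (y - x)\<^sup>2
           \<le> y powr (1 - \<alpha>) - x powr (1 - \<alpha>) - (1 - \<alpha>) * y powr (-\<alpha>) * (y - x) \<and>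
       y powr (1 - \<alpha>) - x powr (1 - \<alpha>) - (1 - \<alpha>) * y powr (-\<alpha>) * (y - x)
           \<le> (1 - \<alpha>) * \<alpha> / 2 * x powr (-\<alpha> - 1) * (y - x)\<^sup>2"
  proof (cases "x = y")
    case False
    obtain \<xi> where xi: "min x y < \<xi>" "\<xi> < max x y"
      and eq: "x powr (1 - \<alpha>) = y powr (1 - \<alpha>) + (1 - \<alpha>) * y powr (-\<alpha>) * (x - y)
       - (1 - \<alpha>) * \<alpha> / 2 * \<xi> powr (-\<alpha> - 1) * (x - y)\<^sup>2"
      using powr_taylor2[of x y \<alpha>] assms False by auto
    have "y powr (-\<alpha> - 1) \<le> \<xi> powr (-\<alpha> - 1)" "\<xi> powr (-\<alpha> - 1) \<le> x powr (-\<alpha> - 1)"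
      using xi assms by (auto intro!: powr_mono2')
    then have "(1 - \<alpha>) * \<alpha> / 2 * y powr (-\<alpha> - 1) * (y - x)\<^sup>2 \<le> (1 - \<alpha>) * \<alpha> / 2 * \<xi> powr (-\<alpha> - 1) * (y - x)\<^sup>2"
      "(1 - \<alpha>) * \<alpha> / 2 * \<xi> powr (-\<alpha> - 1) * (y - x)\<^sup>2 \<le> (1 - \<alpha>) * \<alpha> / 2 * x powr (-\<alpha> - 1) * (y - x)\<^sup>2"
      using assms by (auto intro!: mult_right_mono mult_left_mono)
    moreover have "y powr (1 - \<alpha>) - x powr (1 - \<alpha>) - (1 - \<alpha>) * y powr (-\<alpha>) * (y - x)
      = (1 - \<alpha>) * \<alpha> / 2 * \<xi> powr (-\<alpha> - 1) * (y - x)\<^sup>2"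
      unfolding eq power2_commute[of y x] by (simp add: field_simps)
    ultimately show ?thesis by simp
  qed auto
  then show "(1 - \<alpha>) * \<alpha> / 2 * y powr (-\<alpha> - 1) * (y - x)\<^sup>2
           \<le> y powr (1 - \<alpha>) - x powr (1 - \<alpha>) - (1 - \<alpha>) * y powr (-\<alpha>) * (y - x)"
    and "y powr (1 - \<alpha>) - x powr (1 - \<alpha>) - (1 - \<alpha>) * y powr (-\<alpha>) * (y - x)
           \<le> (1 - \<alpha>) * \<alpha> / 2 * x powr (-\<alpha> - 1) * (y - x)\<^sup>2"
    by blast+
qed

lemma powr_taylor2_right:
  fixes y z \<alpha> :: real
  assumes "0 < y" "y \<le> z" "0 \<le> \<alpha>" "\<alpha> \<le> 1"
  shows "z powr (1 - \<alpha>) - y powr (1 - \<alpha>)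
           \<le> (1 - \<alpha>) * y powr (-\<alpha>) * (z - y) - (1 - \<alpha>) * \<alpha> / 2 * z powr (-\<alpha> - 1) * (z - y)\<^sup>2"
proof (cases "z = y")
  case False
  obtain \<xi> where xi: "min z y < \<xi>" "\<xi> < max z y"
    and eq: "z powr (1 - \<alpha>) = y powr (1 - \<alpha>) + (1 - \<alpha>) * y powr (-\<alpha>) * (z - y)
     - (1 - \<alpha>) * \<alpha> / 2 * \<xi> powr (-\<alpha> - 1) * (z - y)\<^sup>2"
    using powr_taylor2[of z y \<alpha>] assms False by auto
  have "z powr (-\<alpha> - 1) \<le> \<xi> powr (-\<alpha> - 1)"
    using xi assms by (auto intro!: powr_mono2')
  then have "(1 - \<alpha>) * \<alpha> / 2 * z powr (-\<alpha> - 1) * (z - y)\<^sup>2 \<le> (1 - \<alpha>) * \<alpha> / 2 * \<xi> powr (-\<alpha> - 1) * (z - y)\<^sup>2"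
    using assms by (auto intro!: mult_right_mono mult_left_mono)
  then show ?thesis using eq by simp
qed auto

section \<open>Difference quotients and trapezoidal errors of the power function\<close>

definition slope :: "real \<Rightarrow> real \<Rightarrow> real \<Rightarrow> real" where
  "slope \<alpha> x y = (y powr (1 - \<alpha>) - x powr (1 - \<alpha>)) / (y - x)"

text \<open>The integral of \<open>z powr (1 - \<alpha>)\<close> over \<open>[x, y]\<close> minus its trapezoidal value.\<close>
definition trap_defect :: "real \<Rightarrow> real \<Rightarrow> real \<Rightarrow> real" where
  "trap_defect \<alpha> x y = (y powr (2 - \<alpha>) - x powr (2 - \<alpha>)) / (2 - \<alpha>)
     - (y - x) * (x powr (1 - \<alpha>) + y powr (1 - \<alpha>)) / 2"

lemma trap_defect_deriv:
  assumes "0 < y" "0 < \<alpha>" "\<alpha> < 1"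
  shows "(trap_defect \<alpha> x has_real_derivative
     (y powr (1 - \<alpha>) - x powr (1 - \<alpha>) - (1 - \<alpha>) * y powr (-\<alpha>) * (y - x)) / 2) (at y)"
proof -
  have "((\<lambda>y. (y powr (2 - \<alpha>) - x powr (2 - \<alpha>)) / (2 - \<alpha>)) has_real_derivative y powr (1 - \<alpha>)) (at y)"
    by (rule DERIV_cdivide[THEN DERIV_cong]) (use assms in \<open>auto intro!: derivative_eq_intros\<close>)
  moreover have "((\<lambda>y. (y - x) * (x powr (1 - \<alpha>) + y powr (1 - \<alpha>)) / 2) has_real_derivative
      (x powr (1 - \<alpha>) + y powr (1 - \<alpha>) + (1 - \<alpha>) * y powr (-\<alpha>) * (y - x)) / 2) (at y)"
    by (rule DERIV_cdivide) (use assms in \<open>auto intro!: derivative_eq_intros\<close>)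
  ultimately show ?thesis
    unfolding trap_defect_def by (rule DERIV_diff[THEN DERIV_cong]) (simp add: field_simps)
qed

text \<open>The derivative in y is half a Taylor remainder, hence between 0 and a multiple of (y -
  x)^2. Integrating from x gives the cubic, with 1/12 = 1/2 * 1/2 * 1/3; monotonicity of the defect
  and of \<open>K\<close> stands in for the integration.\<close>

lemma trap_defect_bounds:
  assumes "0 < x" "x \<le> y" "0 < \<alpha>" "\<alpha> < 1"
  shows "0 \<le> trap_defect \<alpha> x y"
    and "trap_defect \<alpha> x y \<le> (1 - \<alpha>) * \<alpha> / 12 * x powr (-\<alpha> - 1) * (y - x) ^ 3"
proof -
  have "trap_defect \<alpha> x x \<le> trap_defect \<alpha> x y"
  proof (rule DERIV_nonneg_imp_nondecreasing[OF assms(2)])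
    fix z assume z: "x \<le> z" "z \<le> y"
    have "0 \<le> (1 - \<alpha>) * \<alpha> / 2 * z powr (-\<alpha> - 1) * (z - x)\<^sup>2" using assms by simp
    also have "\<dots> \<le> z powr (1 - \<alpha>) - x powr (1 - \<alpha>) - (1 - \<alpha>) * z powr (-\<alpha>) * (z - x)"
      using z assms by (intro powr_taylor2_left(1)) auto
    finally have "0 \<le> (z powr (1 - \<alpha>) - x powr (1 - \<alpha>) - (1 - \<alpha>) * z powr (-\<alpha>) * (z - x)) / 2" by simp
    with trap_defect_deriv[of z \<alpha> x] z assms
    show "\<exists>d. (trap_defect \<alpha> x has_real_derivative d) (at z) \<and> 0 \<le> d" by force
  qed
  then show "0 \<le> trap_defect \<alpha> x y" by (simp add: trap_defect_def)
  define K where "K = (\<lambda>z. (1 - \<alpha>) * \<alpha> / 12 * x powr (-\<alpha> - 1) * (z - x) ^ 3 - trap_defect \<alpha> x z)"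
  have "K x \<le> K y"
  proof (rule DERIV_nonneg_imp_nondecreasing[OF assms(2)])
    fix z assume z: "x \<le> z" "z \<le> y"
    have d: "(K has_real_derivative ((1 - \<alpha>) * \<alpha> / 4 * x powr (-\<alpha> - 1) * (z - x)\<^sup>2
        - (z powr (1 - \<alpha>) - x powr (1 - \<alpha>) - (1 - \<alpha>) * z powr (-\<alpha>) * (z - x)) / 2)) (at z)"
      unfolding K_def using z assms
      by (auto intro!: derivative_eq_intros trap_defect_deriv)
    moreover have "0 \<le> ((1 - \<alpha>) * \<alpha> / 4 * x powr (-\<alpha> - 1) * (z - x)\<^sup>2
        - (z powr (1 - \<alpha>) - x powr (1 - \<alpha>) - (1 - \<alpha>) * z powr (-\<alpha>) * (z - x)) / 2)"
      using powr_taylor2_left(2)[of x z \<alpha>] z assms by simp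
    ultimately show "\<exists>d. (K has_real_derivative d) (at z) \<and> 0 \<le> d" by blast
  qed
  then show "trap_defect \<alpha> x y \<le> (1 - \<alpha>) * \<alpha> / 12 * x powr (-\<alpha> - 1) * (y - x) ^ 3"
    by (simp add: K_def trap_defect_def)
qed

text \<open>The cubic bound blows up as x tends to 0, so the cell touching the singularity is
  evaluated exactly.\<close>

lemma trap_defect_0:
  assumes "0 < y" "0 < \<alpha>" "\<alpha> < 1"
  shows "trap_defect \<alpha> 0 y = \<alpha> / (2 * (2 - \<alpha>)) * y powr (2 - \<alpha>)"
proof -
  have "y powr (2 - \<alpha>) = y * y powr (1 - \<alpha>)"
    using assms by (simp add: powr_mult_base)
  then show ?thesis unfolding trap_defect_def using assms by (simp add: field_simps)
qed

lemma slope_bounds: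
  assumes "0 < x" "x < y" "0 < \<alpha>" "\<alpha> < 1"
  shows "(1 - \<alpha>) * y powr (-\<alpha>) \<le> slope \<alpha> x y" and "slope \<alpha> x y \<le> (1 - \<alpha>) * x powr (-\<alpha>)"
proof -
  have "0 \<le> (1 - \<alpha>) * \<alpha> / 2 * y powr (-\<alpha> - 1) * (y - x)\<^sup>2" using assms by simp
  then have "(1 - \<alpha>) * y powr (-\<alpha>) * (y - x) \<le> y powr (1 - \<alpha>) - x powr (1 - \<alpha>)"
      "y powr (1 - \<alpha>) - x powr (1 - \<alpha>) \<le> (1 - \<alpha>) * x powr (-\<alpha>) * (y - x)"
    using powr_taylor2_left(1)[of x y \<alpha>] powr_taylor2_right[of x y \<alpha>] assms by linarith+
  then show "(1 - \<alpha>) * y powr (-\<alpha>) \<le> slope \<alpha> x y" and "slope \<alpha> x y \<le> (1 - \<alpha>) * x powr (-\<alpha>)"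
    unfolding slope_def using assms by (simp_all add: field_simps)
qed

text \<open>Both slopes are compared with the derivative at the common point y. Each second-order
  remainder contributes at least half of the bound, the longer cell being replaced by the shorter
  one.\<close>

lemma slope_diff:
  assumes "0 < x" "x < y" "y < z" "y - x \<le> z - y" "0 < \<alpha>" "\<alpha> < 1"
  shows "(1 - \<alpha>) * \<alpha> * z powr (-\<alpha> - 1) * (y - x) \<le> slope \<alpha> x y - slope \<alpha> y z"
proof -
  define c where "c = (1 - \<alpha>) * \<alpha> / 2"
  define q where "q = (1 - \<alpha>) * y powr (-\<alpha>)"
  have c: "0 \<le> c" using assms by (simp add: c_def)
  have "slope \<alpha> x y \<ge> (q * (y - x) + c * y powr (-\<alpha> - 1) * (y - x)\<^sup>2) / (y - x)"
    unfolding slope_def using powr_taylor2_left(1)[of x y \<alpha>] assms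
    by (intro divide_right_mono) (auto simp: c_def q_def)
  also have "(q * (y - x) + c * y powr (-\<alpha> - 1) * (y - x)\<^sup>2) / (y - x) = q + c * y powr (-\<alpha> - 1) * (y - x)"
    using assms by (simp add: add_divide_distrib power2_eq_square)
  finally have 1: "q + c * y powr (-\<alpha> - 1) * (y - x) \<le> slope \<alpha> x y" .
  have "slope \<alpha> y z \<le> (q * (z - y) - c * z powr (-\<alpha> - 1) * (z - y)\<^sup>2) / (z - y)"
    unfolding slope_def using powr_taylor2_right[of y z \<alpha>] assms
    by (intro divide_right_mono) (auto simp: c_def q_def)
  also have "\<dots> = q - c * z powr (-\<alpha> - 1) * (z - y)"
    using assms by (simp add: diff_divide_distrib power2_eq_square)
  finally have 2: "slope \<alpha> y z \<le> q - c * z powr (-\<alpha> - 1) * (z - y)" .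
  have "z powr (-\<alpha> - 1) \<le> y powr (-\<alpha> - 1)" using assms by (intro powr_mono2') auto
  then have "c * z powr (-\<alpha> - 1) * (y - x) \<le> c * y powr (-\<alpha> - 1) * (y - x)"
    using c assms by (intro mult_right_mono mult_left_mono) auto
  moreover have "c * z powr (-\<alpha> - 1) * (y - x) \<le> c * z powr (-\<alpha> - 1) * (z - y)"
    using c assms by (intro mult_left_mono) auto
  ultimately have "2 * (c * z powr (-\<alpha> - 1) * (y - x)) \<le> slope \<alpha> x y - slope \<alpha> y z"
    using 1 2 by linarith
  then show ?thesis by (simp add: c_def mult_ac)
qed

section \<open>Coefficients on nearly uniform meshes\<close>

lemma ln3_bounds: "(1.09::real) \<le> ln 3" "ln 3 \<le> (1.0987::real)"
  using ln_approx_bounds[of 3 5] by (simp_all add: eval_nat_numeral)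

lemma ln2_ge: "(0.6931::real) \<le> ln 2"
  using ln_approx_bounds[of 2 4] by (simp add: eval_nat_numeral)

text \<open>With p = 1 - \<alpha> this is 2 * (2 - \<alpha>) times \<open>penult_gap\<close> at the
  nodes 1, 2, 3.\<close>

definition uniform_gap :: "real \<Rightarrow> real" where
  "uniform_gap p = (3 * p + 15) * 2 powr p - (p + 7) * 3 powr p - 3 * p - 9"

text \<open>In the second derivative the negative term with \<open>3 powr p\<close> wins: for p
  \<ge> 1/2 it carries an extra factor 1.2 against \<open>2 powr p\<close>, and 1.2 * (1.18 p +
  10.49) exceeds 1.45 p + 11.42.\<close>

lemma uniform_gap_concave: "concave_on {1/2..1} uniform_gap"
proof (rule f''_le0_imp_concave)
  let ?D1 = "\<lambda>p::real. (3 + (3 * p + 15) * ln 2) * 2 powr p - (1 + (p + 7) * ln 3) * 3 powr p - 3"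
  let ?D2 = "\<lambda>p::real. ((3 * p + 15) * (ln 2)\<^sup>2 + 6 * ln 2) * 2 powr p
    - ((p + 7) * (ln 3)\<^sup>2 + 2 * ln 3) * 3 powr p"
  fix p :: real assume p: "p \<in> {1/2..1}"
  show "(uniform_gap has_real_derivative ?D1 p) (at p)"
    unfolding uniform_gap_def by (auto intro!: derivative_eq_intros simp: algebra_simps)
  show "(?D1 has_real_derivative ?D2 p) (at p)"
    by (auto intro!: derivative_eq_intros simp: algebra_simps power2_eq_square)
  have "(ln 2)\<^sup>2 \<le> (25/36::real)\<^sup>2" using ln2_le_25_over_36 ln2_ge by (intro power_mono) auto
  then have "(3 * p + 15) * (ln 2)\<^sup>2 \<le> (3 * p + 15) * (25/36::real)\<^sup>2"
    using p by (intro mult_left_mono) auto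
  then have A: "(3 * p + 15) * (ln 2)\<^sup>2 + 6 * ln 2 \<le> 1.45 * p + 11.42"
    using ln2_le_25_over_36 p by (simp add: power2_eq_square field_simps)
  have "(1.09::real)\<^sup>2 \<le> (ln 3)\<^sup>2" using ln3_bounds by (intro power_mono) auto
  then have "(p + 7) * (1.09::real)\<^sup>2 \<le> (p + 7) * (ln 3)\<^sup>2"
    using p by (intro mult_left_mono) auto
  then have B: "1.18 * p + 10.49 \<le> (p + 7) * (ln 3)\<^sup>2 + 2 * ln 3"
    using ln3_bounds p by (simp add: power2_eq_square field_simps)
  have "(1.2::real) \<le> sqrt (3 / 2)" by (rule real_le_rsqrt) (simp add: power2_eq_square)
  also have "\<dots> = (3 / 2) powr (1/2)" by (simp add: powr_half_sqrt)
  also have "\<dots> \<le> (3 / 2) powr p" using p by (intro powr_mono) auto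
  finally have C: "1.2 * 2 powr p \<le> 3 powr p" by (simp add: powr_divide field_simps)
  have "((3 * p + 15) * (ln 2)\<^sup>2 + 6 * ln 2) * 2 powr p \<le> (1.45 * p + 11.42) * 2 powr p"
    using A by (intro mult_right_mono) auto
  also have "\<dots> \<le> (1.18 * p + 10.49) * (1.2 * 2 powr p)"
    using p by (simp add: mult.assoc[symmetric])
  also have "\<dots> \<le> ((p + 7) * (ln 3)\<^sup>2 + 2 * ln 3) * 3 powr p"
    using B C p by (intro mult_mono) auto
  finally show "?D2 p \<le> 0" by simp
qed auto

text \<open>The value is positive but below 10^(-4), hence the many digits. Splitting 0.6262 = 5/8 +
  0.0012 reduces the main factors to eighth roots of 2^5 and 3^5, and leaves a small exponent for
  elementary bounds of exp.\<close>

lemma uniform_gap_at_threshold: "0 < uniform_gap 0.6262"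
proof -
  have "(1.5422108::real) \<le> 2 powr (5/8)"
  proof (rule power_le_imp_le_base)
    show "(1.5422108::real) ^ Suc 7 \<le> (2 powr (5/8)) ^ Suc 7"
      by (simp add: powr_power) (simp add: eval_nat_numeral)
  qed simp
  moreover have "1 + 0.0012 * 0.6931 \<le> 2 powr (0.0012::real)"
  proof -
    have "1 + 0.0012 * 0.6931 \<le> 1 + 0.0012 * ln (2::real)" using ln2_ge by simp
    also have "\<dots> \<le> exp (0.0012 * ln 2)" by (rule exp_ge_add_one_self)
    finally show ?thesis by (simp add: powr_def)
  qed
  ultimately have "1.5422108 * (1 + 0.0012 * 0.6931) \<le> 2 powr (5/8) * 2 powr (0.0012::real)"
    by (intro mult_mono) auto
  then have A: "1.5422108 * (1 + 0.0012 * 0.6931) \<le> 2 powr (0.6262::real)"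
    by (simp flip: powr_add)
  have "3 powr (5/8) \<le> (1.987014::real)"
  proof (rule power_le_imp_le_base)
    show "(3 powr (5/8)) ^ Suc 7 \<le> (1.987014::real) ^ Suc 7"
      by (simp add: powr_power) (simp add: eval_nat_numeral)
  qed simp
  moreover have "3 powr (0.0012::real) \<le> 1 + 0.00131844 + 0.00131844\<^sup>2"
  proof -
    \<comment> \<open>The exponent is 0.0012 * 1.0987, with 1.0987 the upper bound for ln 3.\<close>
    have "3 powr (0.0012::real) \<le> exp 0.00131844" using ln3_bounds by (simp add: powr_def)
    also have "\<dots> \<le> 1 + 0.00131844 + 0.00131844\<^sup>2" by (rule exp_bound) auto
    finally show ?thesis .
  qed
  ultimately have "3 powr (5/8) * 3 powr (0.0012::real) \<le> 1.987014 * (1 + 0.00131844 + 0.00131844\<^sup>2)"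
    by (intro mult_mono) auto
  then have B: "3 powr (0.6262::real) \<le> 1.987014 * (1 + 0.00131844 + 0.00131844\<^sup>2)"
    by (simp flip: powr_add)
  show ?thesis unfolding uniform_gap_def using A B by (simp add: power2_eq_square)
qed

text \<open>A concave function lies above its chords, and the chord from the positive value at
  0.6262 to the zero at 1 is positive before its right end.\<close>

lemma uniform_gap_pos:
  assumes "0.6262 < p" "p < 1"
  shows "0 < uniform_gap p"
proof -
  define t where "t = (p - 0.6262) / 0.3738"
  have t: "0 < t" "t < 1" using assms by (auto simp: t_def field_simps)
  have "(1 - t) * uniform_gap 0.6262 + t * uniform_gap 1 \<le> uniform_gap ((1 - t) *\<^sub>R 0.6262 + t *\<^sub>R 1)"
    using t by (intro concave_onD[OF uniform_gap_concave]) auto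
  also have "(1 - t) *\<^sub>R 0.6262 + t *\<^sub>R 1 = p" by (simp add: t_def field_simps)
  finally have "(1 - t) * uniform_gap 0.6262 + t * uniform_gap 1 \<le> uniform_gap p" .
  moreover have "uniform_gap 1 = 0" by (simp add: uniform_gap_def)
  moreover have "0 < (1 - t) * uniform_gap 0.6262" using t uniform_gap_at_threshold by simp
  ultimately show ?thesis by simp
qed

section \<open>Comparison of coefficients on nearly uniform meshes\<close>

text \<open>Bounding m^\<theta> by m^(3/2) replaces a real power by the decimal check m^3 \<le> r^2;
  the range of \<theta> covers both \<alpha> and \<alpha> + 1.\<close>

lemma powr_neg_le:
  fixes x y :: real
  assumes "0 < x" "0 < y" "y \<le> m * x" "1 \<le> m" "0 \<le> \<theta>" "\<theta> \<le> 3/2" "m ^ 3 \<le> r\<^sup>2" "0 \<le> r"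
  shows "x powr (-\<theta>) \<le> r * y powr (-\<theta>)"
proof -
  have "m powr \<theta> \<le> m powr (3/2)" using assms by (intro powr_mono) auto
  also have "m powr (3/2) = sqrt (m ^ 3)"
    using assms by (simp add: powr_half_sqrt[symmetric] powr_powr flip: powr_numeral)
  also have "\<dots> \<le> r" using assms by (intro real_le_lsqrt) auto
  finally have "m powr \<theta> \<le> r" .
  have "y powr \<theta> \<le> (m * x) powr \<theta>" using assms by (intro powr_mono2) auto
  also have "\<dots> = m powr \<theta> * x powr \<theta>" using assms by (simp add: powr_mult)
  also have "\<dots> \<le> r * x powr \<theta>" using \<open>m powr \<theta> \<le> r\<close> by (intro mult_right_mono) auto
  finally show ?thesis using assms by (simp add: powr_minus field_simps)
qed

text \<open>Two divisions by lengths at least y - x cancel two of the three factors in the cubic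
  bound.\<close>

lemma trap_defect_div_le:
  assumes "0 < x" "x < y" "0 < \<alpha>" "\<alpha> < 1" "y - x \<le> s"
  shows "trap_defect \<alpha> x y / (y - x) / s \<le> (1 - \<alpha>) * \<alpha> / 12 * x powr (-\<alpha> - 1) * (y - x)"
proof -
  have "trap_defect \<alpha> x y / (y - x) / s \<le> trap_defect \<alpha> x y / (y - x) / (y - x)"
    using assms trap_defect_bounds(1)[of x y \<alpha>] by (intro divide_left_mono) auto
  also have "\<dots> \<le> (1 - \<alpha>) * \<alpha> / 12 * x powr (-\<alpha> - 1) * (y - x) ^ 3 / (y - x) / (y - x)"
    using assms trap_defect_bounds(2)[of x y \<alpha>] by (intro divide_right_mono) auto
  also have "\<dots> = (1 - \<alpha>) * \<alpha> / 12 * x powr (-\<alpha> - 1) * (y - x)"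
  proof -
    have "C * w ^ 3 / w / w = C * w" for C w :: real by (simp add: power3_eq_cube)
    then show ?thesis .
  qed
  finally show ?thesis .
qed

text \<open>For four consecutive nodes e < d < c < b, the slopes differ by at least K
  b^(-\<alpha>-1) (c - d). \<open>B1\<close> helps on both sides, while \<open>B2\<close> and
  \<open>B0\<close> cost at most the fractions 29/40 and 357/2000 of this gain, together less than
  1.\<close>

lemma coeff_mono_far:
  assumes "0 < \<alpha>" "\<alpha> < 0.3738" "0 < e" "e < d" "d - e \<le> 1.02 * e" "d - e \<le> c - d" "c - d \<le> 1.02 * (d - e)"
    "c - d \<le> b - c" "b - c \<le> 1.02 * (c - d)"
    and B2: "B2 \<le> trap_defect \<alpha> e d / (d - e)" and B1: "0 \<le> B1" and B0: "B0 \<le> trap_defect \<alpha> c b / (b - c)"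
  shows "slope \<alpha> c b + (B0 - B1) / (b - c) \<le> slope \<alpha> d c + (B1 - B2) / (c - d)"
proof -
  define K where "K = (1 - \<alpha>) * \<alpha>"
  have K: "0 < K" using assms by (simp add: K_def)
  have pos: "e < d" "d < c" "c < b" using assms by linarith+
  have 1: "K * b powr (-\<alpha> - 1) * (c - d) \<le> slope \<alpha> d c - slope \<alpha> c b"
    unfolding K_def using assms pos by (intro slope_diff) auto
  have "B2 / (c - d) \<le> trap_defect \<alpha> e d / (d - e) / (c - d)"
    using B2 pos by (intro divide_right_mono) auto
  also have "\<dots> \<le> K / 12 * e powr (-\<alpha> - 1) * (d - e)"
    unfolding K_def using assms pos by (intro trap_defect_div_le) auto
  also have "\<dots> \<le> K / 12 * e powr (-\<alpha> - 1) * (c - d)"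
    using assms K by (intro mult_left_mono) auto
  \<comment> \<open>The step ratios give b \<le> (1 + 1.02 + 1.02^2 + 1.02^3) e < 4.2 e, and 4.2^3
    \<le> 8.7^2.\<close>
  also have "\<dots> \<le> K / 12 * (8.7 * b powr (-\<alpha> - 1)) * (c - d)"
    using powr_neg_le[of e b "4.2" "\<alpha> + 1" "8.7"] assms K pos
    by (intro mult_right_mono mult_left_mono) (auto simp: eval_nat_numeral)
  finally have 2: "B2 / (c - d) \<le> 29 / 40 * (K * b powr (-\<alpha> - 1) * (c - d))" by simp
  have "B0 / (b - c) \<le> trap_defect \<alpha> c b / (b - c) / (b - c)"
    using B0 pos by (intro divide_right_mono) auto
  also have "\<dots> \<le> K / 12 * c powr (-\<alpha> - 1) * (b - c)"
    unfolding K_def using assms pos by (intro trap_defect_div_le) auto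
  also have "\<dots> \<le> K / 12 * c powr (-\<alpha> - 1) * (1.02 * (c - d))"
    using assms K by (intro mult_left_mono) auto
  also have "\<dots> \<le> K / 12 * (2.1 * b powr (-\<alpha> - 1)) * (1.02 * (c - d))"
    using powr_neg_le[of c b "1.6" "\<alpha> + 1" "2.1"] assms K pos
    by (intro mult_right_mono mult_left_mono) (auto simp: eval_nat_numeral)
  finally have 3: "B0 / (b - c) \<le> 357 / 2000 * (K * b powr (-\<alpha> - 1) * (c - d))"
    by (simp add: algebra_simps)
  have "0 \<le> K * b powr (-\<alpha> - 1) * (c - d)" using K pos by simp
  moreover have "0 \<le> B1 / (b - c)" "0 \<le> B1 / (c - d)" using B1 pos by auto
  ultimately show ?thesis using 1 2 3 unfolding diff_divide_distrib by linarith
qed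

text \<open>The final nodes are 0 < d < c. The singular cell makes \<open>B1\<close> dominate
  \<open>B0\<close>, so the corrections act in the right direction, and the slopes are separated by
  the derivative at d.\<close>

lemma coeff_mono_last:
  assumes "0 < \<alpha>" "\<alpha> < 1" "0 < d" "d < c" "c - d \<le> 1.02 * d"
    and B0: "B0 \<le> trap_defect \<alpha> d c / (c - d)" and B1: "B1 = 2 * trap_defect \<alpha> 0 d / c"
  shows "slope \<alpha> d c + (B0 - B1) / (c - d) \<le> slope \<alpha> 0 d + B1 / d"
proof -
  have dp: "d powr (2 - \<alpha>) = d * d powr (1 - \<alpha>)" using assms by (simp add: powr_mult_base)
  have dq: "d powr (1 - \<alpha>) = d * d powr (-\<alpha>)" using assms powr_mult_base[of d "-\<alpha>"] by simp
  have dr: "d powr (-\<alpha>) = d * d powr (-\<alpha> - 1)" using assms powr_mult_base[of d "-\<alpha> - 1"] by simp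
  have B1': "B1 = \<alpha> / (2 - \<alpha>) * d powr (1 - \<alpha>) * (d / c)"
  proof -
    have "2 * (\<alpha> / (2 * m) * (d * q)) / c = \<alpha> / m * q * (d / c)" for m q :: real by simp
    then show ?thesis unfolding B1 trap_defect_0[OF assms(3,1,2)] dp .
  qed
  \<comment> \<open>Here 50/101 = 1/2.02 is the lower bound for d / c.\<close>
  have "\<alpha> / 2 * d powr (1 - \<alpha>) * (50 / 101) \<le> B1"
    unfolding B1' using assms by (intro mult_mono divide_left_mono) (auto simp: field_simps)
  \<comment> \<open>The constant is 1.02^2 / 12, well below the 25/101 obtained for
    \<open>B1\<close>.\<close>
  moreover have "B0 \<le> \<alpha> * d powr (1 - \<alpha>) * (867/10000)"
  proof -
    have "trap_defect \<alpha> d c / (c - d) \<le> (1 - \<alpha>) * \<alpha> / 12 * d powr (-\<alpha> - 1) * (c - d) ^ 3 / (c - d)"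
      using assms trap_defect_bounds(2)[of d c \<alpha>] by (intro divide_right_mono) auto
    also have "\<dots> = (1 - \<alpha>) * \<alpha> / 12 * d powr (-\<alpha> - 1) * (c - d)\<^sup>2"
    proof -
      have "C * w ^ 3 / w = C * w\<^sup>2" for C w :: real by (simp add: power3_eq_cube power2_eq_square)
      then show ?thesis .
    qed
    also have "\<dots> \<le> 1 * \<alpha> / 12 * d powr (-\<alpha> - 1) * (1.02 * d)\<^sup>2"
    proof (rule mult_mono)
      show "(1 - \<alpha>) * \<alpha> / 12 * d powr (-\<alpha> - 1) \<le> 1 * \<alpha> / 12 * d powr (-\<alpha> - 1)"
        using assms by (intro mult_right_mono divide_right_mono) auto
      show "(c - d)\<^sup>2 \<le> (1.02 * d)\<^sup>2" using assms by (intro power_mono) auto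
    qed (use assms in auto)
    also have "\<dots> = \<alpha> * d powr (1 - \<alpha>) * (867/10000)"
      unfolding dq dr by (simp add: power2_eq_square)
    finally show ?thesis using B0 by linarith
  qed
  moreover have "0 \<le> \<alpha> * d powr (1 - \<alpha>)" using assms by simp
  ultimately have "B0 \<le> B1 \<and> 0 \<le> B1" by (simp add: mult.assoc)
  then have "(B0 - B1) / (c - d) \<le> 0" "0 \<le> B1 / d" using assms(3,4) by (auto simp: divide_nonpos_pos)
  moreover have "slope \<alpha> d c \<le> (1 - \<alpha>) * d powr (-\<alpha>)" using assms by (intro slope_bounds) auto
  moreover have "(1 - \<alpha>) * d powr (-\<alpha>) \<le> d powr (-\<alpha>)" using assms by (simp add: mult_left_le_one_le)
  moreover have "slope \<alpha> 0 d = d powr (-\<alpha>)" using assms by (simp add: slope_def dq)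
  ultimately show ?thesis by linarith
qed

text \<open>The correction takes at most 51/100 of the lower bound for the slope, which leaves more
  than 1/6. The fraction is 6 * 1.02 / 12, the 6 coming from b \<le> 3.2 d and 3.2^3 \<le>
  6^2.\<close>

lemma coeff_first_pos:
  assumes "0 < \<alpha>" "\<alpha> < 0.3738" "0 < d" "d < c" "c - d \<le> 1.02 * d" "c - d \<le> b - c" "b - c \<le> 1.02 * (c - d)"
    and B: "B \<le> trap_defect \<alpha> d c / (c - d)"
  shows "(1 - \<alpha>) * b powr (-\<alpha>) / 6 \<le> slope \<alpha> c b - B / (b - c)"
proof -
  have dr: "d powr (-\<alpha>) = d * d powr (-\<alpha> - 1)" using assms powr_mult_base[of d "-\<alpha> - 1"] by simp
  have "B / (b - c) \<le> trap_defect \<alpha> d c / (c - d) / (b - c)"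
    using B assms by (intro divide_right_mono) auto
  also have "\<dots> \<le> (1 - \<alpha>) * \<alpha> / 12 * d powr (-\<alpha> - 1) * (c - d)"
    using assms by (intro trap_defect_div_le) auto
  also have "\<dots> \<le> (1 - \<alpha>) * 1 / 12 * d powr (-\<alpha> - 1) * (1.02 * d)"
    using assms by (intro mult_mono divide_right_mono) auto
  also have "\<dots> = (1 - \<alpha>) * 1.02 / 12 * d powr (-\<alpha>)" by (simp add: dr)
  also have "\<dots> \<le> (1 - \<alpha>) * 1.02 / 12 * (6 * b powr (-\<alpha>))"
    using assms by (intro mult_left_mono powr_neg_le[where m = "3.2"]) (auto simp: eval_nat_numeral)
  also have "\<dots> = 51/100 * ((1 - \<alpha>) * b powr (-\<alpha>))" by (simp add: field_simps)
  finally have "B / (b - c) \<le> 51/100 * ((1 - \<alpha>) * b powr (-\<alpha>))" .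
  moreover have "(1 - \<alpha>) * b powr (-\<alpha>) \<le> slope \<alpha> c b" using assms by (intro slope_bounds) auto
  moreover have "0 \<le> (1 - \<alpha>) * b powr (-\<alpha>)" using assms by simp
  ultimately show ?thesis by linarith
qed

text \<open>Here the second cell touches the singularity, so the exact defect is used; the
  correction takes at most 3/5 of the slope bound.\<close>

lemma coeff_first_pos_0:
  assumes "0 < \<alpha>" "\<alpha> < 0.3738" "0 < c" "c \<le> b - c" "b - c \<le> 1.02 * c"
    and B: "B \<le> trap_defect \<alpha> 0 c / c"
  shows "(1 - \<alpha>) * b powr (-\<alpha>) / 6 \<le> slope \<alpha> c b - B / (b - c)"
proof -
  have dp: "c powr (2 - \<alpha>) = c * c powr (1 - \<alpha>)" using assms by (simp add: powr_mult_base)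
  have dq: "c powr (1 - \<alpha>) = c * c powr (-\<alpha>)" using assms powr_mult_base[of c "-\<alpha>"] by simp
  have E: "trap_defect \<alpha> 0 c = \<alpha> / (2 * (2 - \<alpha>)) * (c * (c * c powr (-\<alpha>)))"
    using assms by (simp add: trap_defect_0 dp dq)
  have "B / (b - c) \<le> trap_defect \<alpha> 0 c / c / (b - c)"
    using B assms by (intro divide_right_mono) auto
  also have "\<dots> \<le> trap_defect \<alpha> 0 c / c / c"
    using assms by (intro divide_left_mono) (auto simp: E)
  also have "\<dots> = \<alpha> / (2 * (2 - \<alpha>)) * c powr (-\<alpha>)" using assms by (simp add: E)
  also have "\<dots> \<le> \<alpha> / (2 * (2 - \<alpha>)) * (3 * b powr (-\<alpha>))"
    using assms by (intro mult_left_mono powr_neg_le[where m = "2.02"]) (auto simp: eval_nat_numeral)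
  also have "\<dots> \<le> (0.2 * (1 - \<alpha>)) * (3 * b powr (-\<alpha>))"
  proof (rule mult_right_mono)
    have "\<alpha> / (2 * (2 - \<alpha>)) \<le> \<alpha> / 3" using assms by (intro divide_left_mono) auto
    \<comment> \<open>Equivalent to \<alpha> \<le> 3/8, which lies just above the threshold
      0.3738.\<close>
    also have "\<dots> \<le> 0.2 * (1 - \<alpha>)" using assms by simp
    finally show "\<alpha> / (2 * (2 - \<alpha>)) \<le> 0.2 * (1 - \<alpha>)" .
  qed simp
  finally have "B / (b - c) \<le> 3/5 * ((1 - \<alpha>) * b powr (-\<alpha>))" by (simp add: algebra_simps)
  moreover have "(1 - \<alpha>) * b powr (-\<alpha>) \<le> slope \<alpha> c b" using assms by (intro slope_bounds) auto
  moreover have "0 \<le> (1 - \<alpha>) * b powr (-\<alpha>)" using assms by simp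
  ultimately show ?thesis by linarith
qed

section \<open>The delicate comparison next to the singularity\<close>

text \<open>A lower bound for the difference of the last but one and the last but two coefficient,
  when the mesh ends with \<open>0 < d < c < b\<close>.\<close>
definition penult_gap :: "real \<Rightarrow> real \<Rightarrow> real \<Rightarrow> real \<Rightarrow> real" where
  "penult_gap \<alpha> d c b = slope \<alpha> d c - slope \<alpha> c b
     + (2 * trap_defect \<alpha> d c / (b - d) - 2 * trap_defect \<alpha> 0 d / c) / (c - d)
     + (2 * trap_defect \<alpha> d c / (b - d) - trap_defect \<alpha> c b / (b - c)) / (b - c)"

lemma penult_gap_uniform_pos:
  assumes "0 < \<alpha>" "\<alpha> < 0.3738"
  shows "0 < penult_gap \<alpha> 1 2 3"
proof -
  have 2: "2 powr (2 - \<alpha>) = 2 * 2 powr (1 - \<alpha>)" by (simp add: powr_mult_base)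
  have 3: "3 powr (2 - \<alpha>) = 3 * 3 powr (1 - \<alpha>)" by (simp add: powr_mult_base)
  have "2 * (2 - \<alpha>) * penult_gap \<alpha> 1 2 3 = uniform_gap (1 - \<alpha>)"
  proof -
    define m where "m = 2 - \<alpha>"
    have m: "0 < m" "1 - \<alpha> = m - 1" using assms by (auto simp: m_def)
    \<comment> \<open>With P, Q for the powers of 2 and 3 and m = 2 - \<alpha>, only a rational
      identity remains.\<close>
    have "2 * m * (P - 1 - (Q - P) + (2 * ((2 * P - 1) / m - (1 + P) / 2) / 2 - 2 * (1 / m - 1 / 2) / 2)
        + (2 * ((2 * P - 1) / m - (1 + P) / 2) / 2 - ((3 * Q - 2 * P) / m - (P + Q) / 2)))
        = (3 * (m - 1) + 15) * P - ((m - 1) + 7) * Q - 3 * (m - 1) - 9" for P Q :: real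
      using m(1) by (simp add: field_simps)
    from this[of "2 powr (m - 1)" "3 powr (m - 1)"] show ?thesis
      unfolding penult_gap_def slope_def trap_defect_def uniform_gap_def 2 3 m(2) by (simp add: m_def)
  qed
  moreover have "0 < uniform_gap (1 - \<alpha>)" using assms by (intro uniform_gap_pos) auto
  ultimately have "0 < 2 * (2 - \<alpha>) * penult_gap \<alpha> 1 2 3" by linarith
  then show ?thesis using assms by (simp add: zero_less_mult_iff)
qed

lemma slope_scale:
  assumes "0 < l" "0 \<le> x" "0 \<le> y"
  shows "slope \<alpha> (l * x) (l * y) = l powr (-\<alpha>) * slope \<alpha> x y"
proof -
  have "l powr (1 - \<alpha>) = l * l powr (-\<alpha>)" using assms powr_mult_base[of l "-\<alpha>"] by simp
  then have "slope \<alpha> (l * x) (l * y) = (l * (l powr (-\<alpha>) * (y powr (1 - \<alpha>) - x powr (1 - \<alpha>)))) / (l * (y - x))"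
    unfolding slope_def using assms by (simp add: powr_mult algebra_simps)
  also have "\<dots> = l powr (-\<alpha>) * slope \<alpha> x y" using assms by (simp add: slope_def)
  finally show ?thesis .
qed

text \<open>Homogeneity of degree 2 - \<alpha>. Two factors l stay explicit so that the two
  divisions by lengths in \<open>penult_gap\<close> can cancel them.\<close>

lemma trap_defect_scale:
  assumes "0 < l" "0 \<le> x" "0 \<le> y"
  shows "trap_defect \<alpha> (l * x) (l * y) = l * (l * (l powr (-\<alpha>) * trap_defect \<alpha> x y))"
proof -
  have 1: "l powr (1 - \<alpha>) = l * l powr (-\<alpha>)" using assms powr_mult_base[of l "-\<alpha>"] by simp
  have 2: "l powr (2 - \<alpha>) = l * (l * l powr (-\<alpha>))" using assms powr_mult_base[of l "1 - \<alpha>"] 1 by simp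
  have "trap_defect \<alpha> (l * x) (l * y) = (l * (l * l powr (-\<alpha>))) * ((y powr (2 - \<alpha>) - x powr (2 - \<alpha>)) / (2 - \<alpha>))
     - (l * (l * l powr (-\<alpha>))) * ((y - x) * (x powr (1 - \<alpha>) + y powr (1 - \<alpha>)) / 2)"
    unfolding trap_defect_def using assms by (simp add: powr_mult 1 2 algebra_simps diff_divide_distrib)
  also have "\<dots> = l * (l * (l powr (-\<alpha>) * trap_defect \<alpha> x y))"
    by (simp add: trap_defect_def algebra_simps)
  finally show ?thesis .
qed

lemma penult_gap_scale:
  assumes "0 < l" "0 \<le> d" "0 \<le> c" "0 \<le> b"
  shows "penult_gap \<alpha> (l * d) (l * c) (l * b) = l powr (-\<alpha>) * penult_gap \<alpha> d c b"
proof -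
  have q: "(2 * (l * (l * (l powr (-\<alpha>) * u)))) / (l * v) = l * (l powr (-\<alpha>) * (2 * u / v))"
    "l * (l * (l powr (-\<alpha>) * u)) / (l * v) = l * (l powr (-\<alpha>) * (u / v))"
    "l * (l powr (-\<alpha>) * u - l powr (-\<alpha>) * w) / (l * v) = l powr (-\<alpha>) * ((u - w) / v)" for u v w
    using assms by (auto simp flip: right_diff_distrib)
  have z: "trap_defect \<alpha> 0 (l * d) = l * (l * (l powr (-\<alpha>) * trap_defect \<alpha> 0 d))"
    using assms trap_defect_scale[of l 0 d \<alpha>] by simp
  show ?thesis
    unfolding penult_gap_def slope_scale[OF assms(1,2,3)] slope_scale[OF assms(1,3,4)] z
      trap_defect_scale[OF assms(1,2,3)] trap_defect_scale[OF assms(1,3,4)] right_diff_distrib[of l, symmetric] q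
    by (simp only: distrib_left right_diff_distrib[of "l powr (-\<alpha>)"])
qed

text \<open>Homogeneity of degree -\<alpha> allows the normalisation d = 1. Near-uniformity then
  says that (c/d, b/d) is close to (2, 3), where positivity persists by continuity.\<close>

lemma penult_gap_pos_near_uniform:
  assumes "0 < \<alpha>" "\<alpha> < 0.3738"
  obtains \<delta> where "0 < \<delta>"
    "\<And>d c b. 0 < d \<Longrightarrow> d \<le> c - d \<Longrightarrow> c - d \<le> (1 + \<delta>) * d \<Longrightarrow> c - d \<le> b - c
       \<Longrightarrow> b - c \<le> (1 + \<delta>) * (c - d) \<Longrightarrow> 0 < penult_gap \<alpha> d c b"
proof -
  let ?f = "\<lambda>z::real \<times> real. penult_gap \<alpha> 1 (fst z) (snd z)"
  have "isCont ?f (2, 3)"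
    unfolding penult_gap_def slope_def trap_defect_def by (intro continuous_intros) (use assms in auto)
  then have "(?f \<longlongrightarrow> ?f (2, 3)) (nhds (2, 3))"
    using tendsto_at_iff_tendsto_nhds[of ?f "(2, 3)"] by (simp only: isCont_def)
  then have "\<forall>\<^sub>F z in nhds (2, 3). 0 < ?f z"
    using penult_gap_uniform_pos[OF assms] by (intro order_tendstoD(1)) auto
  then obtain \<epsilon> where e: "0 < \<epsilon>" "\<And>z. dist z (2, 3) < \<epsilon> \<Longrightarrow> 0 < ?f z"
    unfolding eventually_nhds_metric by blast
  \<comment> \<open>The deviations of c/d from 2 and of b/d from 3 are at most \<delta> and 4
    \<delta>, the latter by \<delta> \<le> 1; their sum 5 \<delta> stays below \<epsilon>.\<close>
  define \<delta> where "\<delta> = min 1 (\<epsilon> / 8)"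
  have d: "0 < \<delta>" "\<delta> \<le> 1" "8 * \<delta> \<le> \<epsilon>" using e by (auto simp: \<delta>_def)
  show ?thesis
  proof (rule that[OF d(1)])
    fix d c b :: real
    assume A: "0 < d" "d \<le> c - d" "c - d \<le> (1 + \<delta>) * d" "c - d \<le> b - c" "b - c \<le> (1 + \<delta>) * (c - d)"
    define u v where "u = c / d - 2" and "v = b / d - 3"
    have cb: "c = d * (2 + u)" "b = d * (3 + v)" using A by (auto simp: u_def v_def field_simps)
    have "d * 0 \<le> d * u" "d * u \<le> d * \<delta>" "d * u \<le> d * (v - u)" "d * (v - u) \<le> d * (u + \<delta> * (1 + u))"
      using A unfolding cb by (auto simp: algebra_simps)
    then have uv: "0 \<le> u" "u \<le> \<delta>" "u \<le> v - u" "v - u \<le> u + \<delta> * (1 + u)"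
      using A(1) by (auto simp only: mult_le_cancel_left_pos)
    have "\<delta> * (1 + u) \<le> \<delta> * 2" using uv d by (intro mult_left_mono) auto
    then have "v \<le> 4 * \<delta>" using uv by linarith
    have "dist (2 + u, 3 + v) (2::real, 3::real) \<le> \<bar>u\<bar> + \<bar>v\<bar>"
      by (simp add: dist_Pair_Pair dist_real_def sqrt_sum_squares_le_sum_abs)
    also have "\<dots> < \<epsilon>" using uv d \<open>v \<le> 4 * \<delta>\<close> by linarith
    finally have "0 < penult_gap \<alpha> 1 (2 + u) (3 + v)" using e(2) by force
    then have "0 < d powr (-\<alpha>) * penult_gap \<alpha> 1 (2 + u) (3 + v)" using A by simp
    also have "\<dots> = penult_gap \<alpha> (d * 1) (d * (2 + u)) (d * (3 + v))"
      using A uv by (intro penult_gap_scale[symmetric]) auto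
    finally show "0 < penult_gap \<alpha> d c b" by (simp add: cb)
  qed
qed

section \<open>The logarithmic mesh\<close>

text \<open>\<open>X j\<close> abstracts ln (t_k / t_j), the logarithmic distance from t_j to the
  current time. The cap 0.02 on \<delta> yields the ratio 1.02 of the comparison lemmas.\<close>

locale near_uniform_mesh =
  fixes \<alpha> \<delta> :: real and X :: "nat \<Rightarrow> real" and k :: nat
  assumes alpha: "0 < \<alpha>" "\<alpha> < 0.3738"
    and delta: "0 < \<delta>" "\<delta> \<le> 0.02"
    and penult_gap_pos: "\<And>d c b. 0 < d \<Longrightarrow> d \<le> c - d \<Longrightarrow> c - d \<le> (1 + \<delta>) * d \<Longrightarrow> c - d \<le> b - c
       \<Longrightarrow> b - c \<le> (1 + \<delta>) * (c - d) \<Longrightarrow> 0 < penult_gap \<alpha> d c b"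
    and k: "1 \<le> k"
    and X_end: "X k = 0"
    and X_dec: "\<And>j. j < k \<Longrightarrow> X (Suc j) < X j"
    and step_mono: "\<And>j. Suc j < k \<Longrightarrow> X (Suc j) - X (Suc (Suc j)) \<le> X j - X (Suc j)"
    and step_ratio: "\<And>j. Suc j < k \<Longrightarrow> X j - X (Suc j) \<le> (1 + \<delta>) * (X (Suc j) - X (Suc (Suc j)))"
begin

text \<open>\<open>B i\<close> is \<open>-b\<^sub>i\<^sub>,\<^sub>k\<close>, extended by 0 to the two ends so that one formula covers all coefficients.\<close>
definition B :: "nat \<Rightarrow> real" where
  "B i = (if i = 1 \<or> i = Suc k then 0 else 2 * trap_defect \<alpha> (X i) (X (i - 1)) / (X (i - 2) - X i))"

text \<open>This is \<open>Gamma (2 - \<alpha>)\<close> times the coefficient of the scheme, see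
  \<open>L12_c_eq_coeff\<close>.\<close>

definition coeff :: "nat \<Rightarrow> real" where
  "coeff i = slope \<alpha> (X i) (X (i - 1)) + (B i - B (Suc i)) / (X (i - 1) - X i)"

lemma B_first: "B 1 = 0"
  by (simp add: B_def)

lemma X_pos: "j < k \<Longrightarrow> 0 < X j"
proof (induction "k - j" arbitrary: j)
  case (Suc n)
  have "n = k - Suc j" using Suc.hyps(2) by simp
  then have "0 \<le> X (Suc j)" using Suc.hyps(1)[of "Suc j"] Suc.prems X_end by (cases "Suc j = k") auto
  then show ?case using X_dec[of j] Suc.prems by simp
qed simp

lemma X_nonneg: "j \<le> k \<Longrightarrow> 0 \<le> X j"
  using X_pos[of j] X_end by (cases "j = k") auto

lemma step_ratio': "Suc j < k \<Longrightarrow> X j - X (Suc j) \<le> 1.02 * (X (Suc j) - X (Suc (Suc j)))"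
proof -
  assume j: "Suc j < k"
  have "X j - X (Suc j) \<le> (1 + \<delta>) * (X (Suc j) - X (Suc (Suc j)))" by (rule step_ratio[OF j])
  also have "\<dots> \<le> 1.02 * (X (Suc j) - X (Suc (Suc j)))"
    using delta X_dec[OF j] by (intro mult_right_mono) auto
  finally show ?thesis .
qed

lemma trap_defect_nonneg: "j < k \<Longrightarrow> 0 \<le> trap_defect \<alpha> (X (Suc j)) (X j)"
  using X_dec[of j] X_end X_pos[of j] X_pos[of "Suc j"] alpha
  by (cases "Suc j = k") (auto simp: trap_defect_0 intro!: trap_defect_bounds)

text \<open>The preceding step is at least as long, so the denominator of \<open>B i\<close> is at
  least twice the cell length, which absorbs the factor 2.\<close>

lemma B_bounds:
  assumes "1 \<le> i" "i \<le> k"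
  shows "0 \<le> B i" "B i \<le> trap_defect \<alpha> (X i) (X (i - 1)) / (X (i - 1) - X i)"
proof -
  have "0 \<le> B i \<and> B i \<le> trap_defect \<alpha> (X i) (X (i - 1)) / (X (i - 1) - X i)"
  proof (cases "i = 1")
    case True
    then show ?thesis using trap_defect_nonneg[of 0] X_dec[of 0] assms by (simp add: B_def)
  next
    case False
    then obtain j where j: "i = Suc (Suc j)" using assms by (metis One_nat_def Suc_le_D Suc_le_mono not0_implies_Suc)
    define s where "s = X (Suc j) - X i"
    have s: "0 < s" "2 * s \<le> X j - X i"
      using step_mono[of j] X_dec[of "Suc j"] assms by (auto simp: s_def j)
    have E: "0 \<le> trap_defect \<alpha> (X i) (X (Suc j))" using trap_defect_nonneg[of "Suc j"] assms by (simp add: j)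
    have "2 * trap_defect \<alpha> (X i) (X (Suc j)) / (X j - X i) \<le> 2 * trap_defect \<alpha> (X i) (X (Suc j)) / (2 * s)"
      using s E by (intro divide_left_mono) auto
    then have "2 * trap_defect \<alpha> (X i) (X (Suc j)) / (X j - X i) \<le> trap_defect \<alpha> (X i) (X (Suc j)) / s" by simp
    moreover have "0 \<le> 2 * trap_defect \<alpha> (X i) (X (Suc j)) / (X j - X i)"
      using s E by (intro divide_nonneg_nonneg) auto
    moreover have "B i = 2 * trap_defect \<alpha> (X i) (X (Suc j)) / (X j - X i)"
      using assms by (simp add: B_def j)
    ultimately show ?thesis by (simp add: s_def j)
  qed
  then show "0 \<le> B i" "B i \<le> trap_defect \<alpha> (X i) (X (i - 1)) / (X (i - 1) - X i)" by auto
qed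

text \<open>The cases follow the distance to the singularity: i = k - 1 is the last pair, i = k - 2
  the delicate one, and all earlier pairs are far.\<close>

lemma coeff_mono:
  assumes "1 \<le> i" "i < k"
  shows "coeff i \<le> coeff (Suc i)"
proof -
  obtain j where j: "i = Suc j" using assms by (cases i) auto
  have Bi: "B i \<le> trap_defect \<alpha> (X (Suc j)) (X j) / (X j - X (Suc j))"
    using B_bounds(2)[of i] assms by (simp add: j)
  consider "k = Suc (Suc j)" | "k = Suc (Suc (Suc j))" | "Suc (Suc (Suc j)) < k" using assms j by linarith
  then show ?thesis
  proof cases
    case 1
    have "X j - X (Suc j) \<le> 1.02 * X (Suc j)" using step_ratio'[of j] X_end 1 by simp
    moreover have "B (Suc i) = 2 * trap_defect \<alpha> 0 (X (Suc j)) / X j"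
      unfolding B_def using 1 X_end j by simp
    ultimately have "slope \<alpha> (X (Suc j)) (X j) + (B i - B (Suc i)) / (X j - X (Suc j))
        \<le> slope \<alpha> 0 (X (Suc j)) + B (Suc i) / X (Suc j)"
      using alpha X_pos[of "Suc j"] X_dec[of j] assms j Bi
      by (intro coeff_mono_last) auto
    then show ?thesis using 1 X_end j unfolding coeff_def B_def by simp
  next
    case 2
    define d c b where "d = X (Suc (Suc j))" "c = X (Suc j)" "b = X j"
    have "0 < penult_gap \<alpha> d c b"
      using X_pos[of "Suc (Suc j)"] step_mono[of j] step_mono[of "Suc j"] step_ratio[of j]
        step_ratio[of "Suc j"] X_end 2 by (intro penult_gap_pos) (auto simp: d_c_b_def)
    then have "slope \<alpha> c b + (trap_defect \<alpha> c b / (b - c) - 2 * trap_defect \<alpha> d c / (b - d)) / (b - c)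
       < slope \<alpha> d c + (2 * trap_defect \<alpha> d c / (b - d) - 2 * trap_defect \<alpha> 0 d / c) / (c - d)"
      unfolding penult_gap_def diff_divide_distrib by linarith
    \<comment> \<open>\<open>penult_gap\<close> contains an upper bound in place of
      \<open>B i\<close>, which also covers i = 1, where \<open>B i\<close> is 0.\<close>
    moreover have "(B i - 2 * trap_defect \<alpha> d c / (b - d)) / (b - c)
        \<le> (trap_defect \<alpha> c b / (b - c) - 2 * trap_defect \<alpha> d c / (b - d)) / (b - c)"
      using Bi X_dec[of j] assms j by (intro divide_right_mono) (auto simp: d_c_b_def)
    moreover have "B (Suc i) = 2 * trap_defect \<alpha> d c / (b - d)" "B (Suc (Suc i)) = 2 * trap_defect \<alpha> 0 d / c"
      unfolding B_def using 2 X_end by (auto simp: j d_c_b_def)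
    ultimately show ?thesis by (simp add: coeff_def j d_c_b_def)
  next
    case 3
    \<comment> \<open>The node after e is nonnegative, so the step following e is at most e
      itself.\<close>
    have "X (Suc (Suc j)) - X (Suc (Suc (Suc j))) \<le> 1.02 * X (Suc (Suc (Suc j)))"
    proof -
      have "X (Suc (Suc j)) - X (Suc (Suc (Suc j))) \<le> 1.02 * (X (Suc (Suc (Suc j))) - X (Suc (Suc (Suc (Suc j)))))"
        by (rule step_ratio') (use 3 in simp)
      then show ?thesis using X_nonneg[of "Suc (Suc (Suc (Suc j)))"] 3 by simp
    qed
    then have "slope \<alpha> (X (Suc j)) (X j) + (B i - B (Suc i)) / (X j - X (Suc j))
       \<le> slope \<alpha> (X (Suc (Suc j))) (X (Suc j)) + (B (Suc i) - B (Suc (Suc i))) / (X (Suc j) - X (Suc (Suc j)))"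
      using alpha X_pos[of "Suc (Suc (Suc j))"] X_dec[of "Suc (Suc j)"] step_mono[of j] step_mono[of "Suc j"]
        step_ratio'[of j] step_ratio'[of "Suc j"] B_bounds[of "Suc i"] B_bounds[of "Suc (Suc i)"] 3 Bi
      by (intro coeff_mono_far[where e = "X (Suc (Suc (Suc j)))"]) (auto simp: j)
    then show ?thesis by (simp add: coeff_def j)
  qed
qed

text \<open>The factor 1/6 is what becomes the 6 in the stability constant. For k = 1 the
  coefficient is exactly X_0^(-\<alpha>); k = 2 puts the second cell at the singularity.\<close>

lemma coeff_first_ge: "(1 - \<alpha>) * X 0 powr (-\<alpha>) / 6 \<le> coeff 1"
proof -
  consider "k = 1" | "k = 2" | "2 < k" using k by linarith
  then show ?thesis
  proof cases
    case 1
    have X0: "0 < X 0" using X_pos[of 0] 1 by simp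
    have "X 0 powr (1 - \<alpha>) = X 0 * X 0 powr (-\<alpha>)" using X0 powr_mult_base[of "X 0" "-\<alpha>"] by simp
    then have "coeff 1 = X 0 powr (-\<alpha>)" unfolding coeff_def B_def slope_def using 1 X_end X0 by simp
    moreover have "(1 - \<alpha>) / 6 * X 0 powr (-\<alpha>) \<le> 1 * X 0 powr (-\<alpha>)"
      using alpha by (intro mult_right_mono) auto
    ultimately show ?thesis by simp
  next
    case 2
    have "X 2 = 0" using X_end 2 by simp
    then have "(1 - \<alpha>) * X 0 powr (-\<alpha>) / 6 \<le> slope \<alpha> (X 1) (X 0) - B 2 / (X 0 - X 1)"
      using alpha X_pos[of 1] step_mono[of 0] step_ratio'[of 0] B_bounds(2)[of 2] eq_imp_le[OF 2[symmetric]]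
      by (intro coeff_first_pos_0) (auto simp: numeral_2_eq_2)
    then show ?thesis using B_first by (simp add: coeff_def numeral_2_eq_2)
  next
    case 3
    have "X 1 - X 2 \<le> 1.02 * X 2"
      using step_ratio'[of 1] X_nonneg[of 3] 3 by (simp add: numeral_2_eq_2 numeral_3_eq_3)
    then have "(1 - \<alpha>) * X 0 powr (-\<alpha>) / 6 \<le> slope \<alpha> (X 1) (X 0) - B 2 / (X 0 - X 1)"
      using alpha X_pos[of 2] X_dec[of 1] step_mono[of 0] step_ratio'[of 0] B_bounds(2)[of 2] 3
      by (intro coeff_first_pos[where d = "X 2"]) (auto simp: numeral_2_eq_2)
    then show ?thesis using B_first by (simp add: coeff_def numeral_2_eq_2)
  qed
qed

end

section \<open>Transfer to the coefficients of the scheme\<close>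

text \<open>Step j is ln (t_(j+1) / t_j), at most \<tau> / t_j, and step j + 1 is at least \<tau> /
  t_(j+2). Their ratio is thus at most t_(j+2) / t_j \<le> 1 + 2 \<tau> / a0 \<le> 1 +
  \<delta>.\<close>

lemma near_uniform_mesh_tgrid:
  fixes a0 T \<alpha> \<delta> :: real and N k :: nat
  defines "t \<equiv> tgrid a0 T N"
  assumes "0 < \<alpha>" "\<alpha> < 0.3738" "0 < \<delta>" "\<delta> \<le> 0.02" "0 < a0" "a0 < T" "0 < N"
    and tau: "(T - a0) / real N \<le> \<delta> * a0 / 2" and k: "1 \<le> k"
    and penult_gap: "\<And>d c b. 0 < d \<Longrightarrow> d \<le> c - d \<Longrightarrow> c - d \<le> (1 + \<delta>) * d \<Longrightarrow> c - d \<le> b - c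
       \<Longrightarrow> b - c \<le> (1 + \<delta>) * (c - d) \<Longrightarrow> 0 < penult_gap \<alpha> d c b"
  shows "near_uniform_mesh \<alpha> \<delta> (\<lambda>j. ln (t k / t j)) k"
proof -
  define \<tau> where "\<tau> = (T - a0) / real N"
  have \<tau>: "0 < \<tau>" using assms by (simp add: \<tau>_def)
  have t: "t j = a0 + real j * \<tau>" for j by (simp add: t_def tgrid_def \<tau>_def)
  have t_ge: "a0 \<le> t j" for j using \<tau> by (simp add: t)
  have tp: "0 < t j" for j using t_ge[of j] assms by linarith
  have tS: "t (Suc j) = t j + \<tau>" for j by (simp add: t algebra_simps)
  have diff: "ln (t k / t j) - ln (t k / t (Suc j)) = ln (t (Suc j) / t j)" for j
    using tp[of j] tp[of k] tp[of "Suc j"] by (simp add: ln_div)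
  show ?thesis
  proof
    fix j
    have "0 < ln (t (Suc j) / t j)" using tp[of j] \<tau> by (simp add: tS)
    then show "ln (t k / t (Suc j)) < ln (t k / t j)" using diff[of j] by linarith
    have "t (Suc (Suc j)) / t (Suc j) \<le> t (Suc j) / t j"
      using tp[of j] \<tau> by (simp add: tS field_simps)
    then show "ln (t k / t (Suc j)) - ln (t k / t (Suc (Suc j))) \<le> ln (t k / t j) - ln (t k / t (Suc j))"
      unfolding diff using tp[of j] tp[of "Suc j"] tp[of "Suc (Suc j)"] by (subst ln_le_cancel_iff) auto
    have "ln (t (Suc j) / t j) \<le> \<tau> / t j"
    proof -
      have "ln (t (Suc j) / t j) \<le> t (Suc j) / t j - 1" using tp by (intro ln_le_minus_one) auto
      also have "\<dots> = \<tau> / t j" using tp[of j] by (simp add: tS field_simps)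
      finally show ?thesis .
    qed
    also have "\<dots> \<le> (1 + \<delta>) * (\<tau> / t (Suc (Suc j)))"
    proof -
      have "\<delta> * a0 \<le> \<delta> * t j" using t_ge[of j] assms by (intro mult_left_mono) auto
      then have "t (Suc (Suc j)) \<le> (1 + \<delta>) * t j" using tau by (simp add: tS \<tau>_def[symmetric] algebra_simps)
      then have "\<tau> * t (Suc (Suc j)) \<le> \<tau> * ((1 + \<delta>) * t j)" using \<tau> by (intro mult_left_mono) auto
      then show ?thesis using tp[of j] tp[of "Suc (Suc j)"] by (simp add: field_simps)
    qed
    also have "\<dots> \<le> (1 + \<delta>) * ln (t (Suc (Suc j)) / t (Suc j))"
    proof (rule mult_left_mono)
      have "ln (t (Suc j) / t (Suc (Suc j))) \<le> t (Suc j) / t (Suc (Suc j)) - 1"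
        using tp by (intro ln_le_minus_one) auto
      also have "\<dots> = - (\<tau> / t (Suc (Suc j)))" using tp[of "Suc (Suc j)"] by (simp add: tS field_simps)
      moreover have "ln (t (Suc j) / t (Suc (Suc j))) = - ln (t (Suc (Suc j)) / t (Suc j))"
        using tp[of "Suc j"] tp[of "Suc (Suc j)"] by (simp add: ln_div)
      ultimately show "\<tau> / t (Suc (Suc j)) \<le> ln (t (Suc (Suc j)) / t (Suc j))" by linarith
    qed (use assms in auto)
    finally show "ln (t k / t j) - ln (t k / t (Suc j)) \<le> (1 + \<delta>) * (ln (t k / t (Suc j)) - ln (t k / t (Suc (Suc j))))"
      unfolding diff .
  qed (use assms tp[of k] in auto)
qed

lemma L12_c_eq_coeff:
  assumes "near_uniform_mesh \<alpha> \<delta> (\<lambda>j. ln (t k / t j)) k" "\<And>j. 0 < t j" "1 \<le> i" "i \<le> k"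
  shows "L12_c \<alpha> t i k = near_uniform_mesh.coeff \<alpha> (\<lambda>j. ln (t k / t j)) k i / Gamma (2 - \<alpha>)"
proof -
  interpret near_uniform_mesh \<alpha> \<delta> "\<lambda>j. ln (t k / t j)" k by fact
  have diff: "ln (t k / t i) - ln (t k / t j) = ln (t j / t i)" for i j
    using assms(2)[of i] assms(2)[of j] assms(2)[of k] by (simp add: ln_div)
  have b: "L12_b \<alpha> t i k = - B i" if "2 \<le> i" "i \<le> k" for i
  proof -
    have e: "ln (t i / t (i - 1)) = ln (t k / t (i - 1)) - ln (t k / t i)" by (simp add: diff)
    \<comment> \<open>Division by zero yields 0, so the identity holds unconditionally and can be
      used for plain rewriting.\<close>
    have alg: "1 / D * (s * (P + Q) + 2 / m * (R - S)) = - (2 * ((S - R) / m - s * (P + Q) / 2) / D)"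
      for D s P Q R S m :: real
      by (cases "D = 0"; cases "m = 0") (simp_all add: field_simps)
    have "ln (t i / t (i - 2)) = ln (t k / t (i - 2)) - ln (t k / t i)" by (simp add: diff)
    then have "L12_b \<alpha> t i k = - (2 * trap_defect \<alpha> (ln (t k / t i)) (ln (t k / t (i - 1))) / (ln (t k / t (i - 2)) - ln (t k / t i)))"
      unfolding L12_b_def trap_defect_def e by (simp only: alg)
    also have "\<dots> = - B i" unfolding B_def using that by auto
    finally show ?thesis .
  qed
  have a: "L12_a \<alpha> t i k / (ln (t i / t (i - 1))) = slope \<alpha> (ln (t k / t i)) (ln (t k / t (i - 1)))" for i
    by (simp add: L12_a_def slope_def diff)
  have B1: "B 1 = 0" "B (Suc k) = 0" by (auto simp: B_def)
  have fr: "x / (Gamma (2 - \<alpha>) * y) = x / y / Gamma (2 - \<alpha>)" for x y by (simp add: mult.commute)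
  consider "k = 1" | "k \<noteq> 1" "i = 1" | "k \<noteq> 1" "i \<noteq> 1" "i < k" | "k \<noteq> 1" "i = k" using assms by linarith
  then show ?thesis
  proof cases
    case 1
    then have "i = 1" using assms by simp
    have "coeff 1 = slope \<alpha> (ln (t k / t 1)) (ln (t k / t 0))"
      unfolding coeff_def B_def using 1 by simp
    moreover have "L12_c \<alpha> t 1 k = L12_a \<alpha> t 1 k / ln (t 1 / t 0) / Gamma (2 - \<alpha>)"
      using 1 by (simp add: L12_c_def mult.commute)
    moreover have "L12_a \<alpha> t 1 k / ln (t 1 / t 0) = slope \<alpha> (ln (t k / t 1)) (ln (t k / t 0))"
      using a[of 1] by simp
    ultimately show ?thesis by (simp only: \<open>i = 1\<close>)
  next
    case 2
    then show ?thesis using assms a[of 1] B1 b[of 2]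
      by (simp add: L12_c_def coeff_def fr diff numeral_2_eq_2 diff_divide_distrib)
  next
    case 3
    then show ?thesis using assms a[of i] B1 b[of i] b[of "Suc i"]
      by (simp add: L12_c_def coeff_def fr diff diff_divide_distrib add_divide_distrib)
  next
    case 4
    then show ?thesis using assms a[of k] B1 b[of k]
      by (simp add: L12_c_def coeff_def fr diff add_divide_distrib)
  qed
qed

text \<open>\<delta> is fixed from \<alpha> alone, so \<delta> a0 / 2 serves as
  \<open>\<tau>0\<close> for every N and k at once. The second bound has the form in which the
  source is later absorbed.\<close>

lemma L12_c_mono_and_first_ge:
  fixes a0 T \<alpha> :: real
  assumes "0 < \<alpha>" "\<alpha> < 0.3738" "0 < a0" "a0 < T"
  obtains \<tau>0 where "0 < \<tau>0"
    "\<And>N i k. 0 < N \<Longrightarrow> (T - a0) / real N \<le> \<tau>0 \<Longrightarrow> 1 \<le> i \<Longrightarrow> i < k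
       \<Longrightarrow> L12_c \<alpha> (tgrid a0 T N) i k \<le> L12_c \<alpha> (tgrid a0 T N) (Suc i) k"
    "\<And>N k. 0 < N \<Longrightarrow> (T - a0) / real N \<le> \<tau>0 \<Longrightarrow> 1 \<le> k
       \<Longrightarrow> 1 \<le> L12_c \<alpha> (tgrid a0 T N) 1 k * (6 * Gamma (1 - \<alpha>) / a0 powr \<alpha> * (real k * ((T - a0) / real N)) powr \<alpha>)"
proof -
  obtain \<epsilon> where \<epsilon>: "0 < \<epsilon>"
    "\<And>d c b. 0 < d \<Longrightarrow> d \<le> c - d \<Longrightarrow> c - d \<le> (1 + \<epsilon>) * d \<Longrightarrow> c - d \<le> b - c
       \<Longrightarrow> b - c \<le> (1 + \<epsilon>) * (c - d) \<Longrightarrow> 0 < penult_gap \<alpha> d c b"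
    using penult_gap_pos_near_uniform[OF assms(1,2)] by blast
  define \<delta> where "\<delta> = min \<epsilon> 0.02"
  have \<delta>: "0 < \<delta>" "\<delta> \<le> 0.02" "\<delta> \<le> \<epsilon>" using \<epsilon> by (auto simp: \<delta>_def)
  have penult_gap: "0 < penult_gap \<alpha> d c b" if "0 < d" "d \<le> c - d" "c - d \<le> (1 + \<delta>) * d" "c - d \<le> b - c"
       "b - c \<le> (1 + \<delta>) * (c - d)" for d c b
  proof (rule \<epsilon>(2))
    show "c - d \<le> (1 + \<epsilon>) * d"
      using that(3) by (rule order_trans) (use that \<delta> in \<open>auto intro!: mult_right_mono\<close>)
    show "b - c \<le> (1 + \<epsilon>) * (c - d)"
      using that(5) by (rule order_trans) (use that \<delta> in \<open>auto intro!: mult_right_mono\<close>)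
  qed (use that in auto)
  have G: "0 < Gamma (2 - \<alpha>)" "0 < Gamma (1 - \<alpha>)" using assms by (auto intro: Gamma_real_pos)
  have G2: "Gamma (2 - \<alpha>) = (1 - \<alpha>) * Gamma (1 - \<alpha>)"
    using Gamma_plus1[of "1 - \<alpha>"] nonpos_Ints_nonpos[of "1 - \<alpha>"] assms by force
  show ?thesis
  proof (rule that[of "\<delta> * a0 / 2"])
    show "0 < \<delta> * a0 / 2" using assms \<delta> by simp
  next
    fix N i k :: nat assume A: "0 < N" "(T - a0) / real N \<le> \<delta> * a0 / 2" "1 \<le> i" "i < k"
    let ?t = "tgrid a0 T N"
    have tp: "0 < ?t j" for j using assms by (simp add: tgrid_def add_pos_nonneg)
    have L: "near_uniform_mesh \<alpha> \<delta> (\<lambda>j. ln (?t k / ?t j)) k"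
      using A assms \<delta> by (intro near_uniform_mesh_tgrid penult_gap) auto
    show "L12_c \<alpha> ?t i k \<le> L12_c \<alpha> ?t (Suc i) k"
      using A G near_uniform_mesh.coeff_mono[OF L A(3,4)]
      by (simp add: L12_c_eq_coeff[OF L tp] divide_right_mono)
  next
    fix N k :: nat assume A: "0 < N" "(T - a0) / real N \<le> \<delta> * a0 / 2" "1 \<le> k"
    let ?t = "tgrid a0 T N"
    define \<tau> where "\<tau> = (T - a0) / real N"
    have \<tau>: "0 < \<tau>" using A assms by (simp add: \<tau>_def)
    have tp: "0 < ?t j" for j using assms by (simp add: tgrid_def add_pos_nonneg)
    have L: "near_uniform_mesh \<alpha> \<delta> (\<lambda>j. ln (?t k / ?t j)) k"
      using A assms \<delta> by (intro near_uniform_mesh_tgrid penult_gap) auto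
    define X where "X = ln (?t k / ?t 0)"
    have X: "0 < X" using near_uniform_mesh.X_pos[OF L, of 0] A by (simp add: X_def)
    \<comment> \<open>The inequality ln (1 + x) \<le> x turns logarithmic distance into k \<tau> /
      a0, the origin of a0^\<alpha> in the constant.\<close>
    have "?t k / ?t 0 = 1 + real k * \<tau> / a0" using assms by (simp add: tgrid_def \<tau>_def add_divide_distrib)
    then have Xle: "X \<le> real k * \<tau> / a0"
      unfolding X_def using A \<tau> assms by (simp add: ln_add_one_self_le_self)
    have c: "X powr (-\<alpha>) / (6 * Gamma (1 - \<alpha>)) \<le> L12_c \<alpha> ?t 1 k"
    proof -
      have "X powr (-\<alpha>) / (6 * Gamma (1 - \<alpha>)) = (1 - \<alpha>) * X powr (-\<alpha>) / 6 / Gamma (2 - \<alpha>)"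
        using assms G by (simp add: G2)
      also have "\<dots> \<le> L12_c \<alpha> ?t 1 k"
        unfolding L12_c_eq_coeff[OF L tp order.refl A(3)] X_def
        using G by (intro divide_right_mono near_uniform_mesh.coeff_first_ge[OF L]) auto
      finally show ?thesis .
    qed
    have "1 = X powr (-\<alpha>) * X powr \<alpha>" using X by (simp flip: powr_add)
    also have "\<dots> \<le> X powr (-\<alpha>) * (real k * \<tau> / a0) powr \<alpha>"
      using X Xle assms by (intro mult_left_mono powr_mono2) auto
    also have "\<dots> = X powr (-\<alpha>) / (6 * Gamma (1 - \<alpha>)) * (6 * Gamma (1 - \<alpha>) / a0 powr \<alpha> * (real k * \<tau>) powr \<alpha>)"
      using less_imp_neq[OF G(2)] assms A \<tau> by (simp add: powr_divide)
    also have "\<dots> \<le> L12_c \<alpha> ?t 1 k * (6 * Gamma (1 - \<alpha>) / a0 powr \<alpha> * (real k * \<tau>) powr \<alpha>)"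
      using c G by (intro mult_right_mono) auto
    finally show "1 \<le> L12_c \<alpha> ?t 1 k * (6 * Gamma (1 - \<alpha>) / a0 powr \<alpha> * (real k * ((T - a0) / real N)) powr \<alpha>)"
      by (simp add: \<tau>_def)
  qed
qed

section \<open>Stability\<close>

lemma hnorm_nonneg: "0 \<le> h \<Longrightarrow> 0 \<le> hnorm h M w"
  unfolding hnorm_def by (intro real_sqrt_ge_zero mult_nonneg_nonneg sum_nonneg) auto

lemma hnorm_Cauchy_Schwarz:
  assumes "0 \<le> h"
  shows "h * (\<Sum>j=1..M-1. v j * w j) \<le> hnorm h M v * hnorm h M w"
proof -
  have "(\<Sum>j=1..M-1. v j * w j) \<le> (\<Sum>j=1..M-1. \<bar>v j\<bar> * \<bar>w j\<bar>)"
    by (intro sum_mono) (simp flip: abs_mult)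
  also have "\<dots> \<le> L2_set v {1..M-1} * L2_set w {1..M-1}" by (rule L2_set_mult_ineq)
  finally have "h * (\<Sum>j=1..M-1. v j * w j) \<le> h * (L2_set v {1..M-1} * L2_set w {1..M-1})"
    using assms by (intro mult_left_mono)
  also have "\<dots> = hnorm h M v * hnorm h M w"
    using assms by (simp add: hnorm_def L2_set_def real_sqrt_mult)
  finally show ?thesis .
qed

text \<open>Testing one time level with \<open>U n\<close> itself: the spatial term drops out by its sign.\<close>
lemma energy_step:
  fixes c :: "nat \<Rightarrow> real" and U :: "nat \<Rightarrow> nat \<Rightarrow> real"
  assumes h: "0 \<le> h"
    and eq: "\<And>j. 1 \<le> j \<Longrightarrow> j \<le> M - 1 \<Longrightarrow>
      c n * U n j + (\<Sum>i=1..n-1. (c i - c (i + 1)) * U i j) - c 1 * U 0 j + A j = F j"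
    and psd: "0 \<le> (\<Sum>j=1..M-1. A j * U n j)"
    and mono: "\<And>i. 1 \<le> i \<Longrightarrow> i < n \<Longrightarrow> c i \<le> c (i + 1)" and c1: "0 \<le> c 1"
  shows "c n * hnorm h M (U n)
    \<le> (\<Sum>i=1..n-1. (c (i + 1) - c i) * hnorm h M (U i)) + c 1 * hnorm h M (U 0) + hnorm h M F"
\<comment> \<open>The main case ends by cancelling one factor \<open>hnorm h M (U n)\<close>, so the
  zero norm is settled first.\<close>
proof (cases "hnorm h M (U n) = 0")
  case True
  have "0 \<le> (\<Sum>i=1..n-1. (c (i + 1) - c i) * hnorm h M (U i))"
    using mono hnorm_nonneg[OF h] by (intro sum_nonneg mult_nonneg_nonneg) auto
  then show ?thesis using True c1 hnorm_nonneg[OF h] by simp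
next
  case False
  let ?I = "\<lambda>v w. \<Sum>j=1..M-1. (v j :: real) * w j"
  let ?n = "\<lambda>w. hnorm h M w"
  have sq: "h * ?I (U n) (U n) = ?n (U n) * ?n (U n)"
  proof -
    have "0 \<le> h * (\<Sum>j=1..M-1. (U n j)\<^sup>2)" using h by (intro mult_nonneg_nonneg sum_nonneg) auto
    then show ?thesis unfolding hnorm_def by (simp add: power2_eq_square)
  qed
  have "c n * ?I (U n) (U n) = (\<Sum>j=1..M-1. ((\<Sum>i=1..n-1. (c (i + 1) - c i) * U i j) + c 1 * U 0 j + F j - A j) * U n j)"
    unfolding sum_distrib_left
  proof (rule sum.cong[OF refl])
    fix j assume "j \<in> {1..M-1}"
    then have e: "c n * U n j + (\<Sum>i=1..n-1. (c i - c (i + 1)) * U i j) - c 1 * U 0 j + A j = F j"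
      using eq by simp
    have "(\<Sum>i=1..n-1. (c i - c (i + 1)) * U i j) = - (\<Sum>i=1..n-1. (c (i + 1) - c i) * U i j)"
      by (simp add: left_diff_distrib flip: sum_negf)
    with e have "c n * U n j = (\<Sum>i=1..n-1. (c (i + 1) - c i) * U i j) + c 1 * U 0 j + F j - A j" by linarith
    then show "c n * (U n j * U n j) = ((\<Sum>i=1..n-1. (c (i + 1) - c i) * U i j) + c 1 * U 0 j + F j - A j) * U n j"
      by (metis mult.assoc)
  qed
  also have "\<dots> = (\<Sum>j=1..M-1. \<Sum>i=1..n-1. (c (i + 1) - c i) * (U i j * U n j))
      + c 1 * ?I (U 0) (U n) + ?I F (U n) - ?I A (U n)"
    by (simp add: sum.distrib sum_subtractf distrib_right left_diff_distrib[of _ "A _"] sum_distrib_right sum_distrib_left mult.assoc)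
  also have "(\<Sum>j=1..M-1. \<Sum>i=1..n-1. (c (i + 1) - c i) * (U i j * U n j))
      = (\<Sum>i=1..n-1. (c (i + 1) - c i) * ?I (U i) (U n))"
    by (subst sum.swap) (simp add: sum_distrib_left)
  finally have "c n * ?I (U n) (U n) \<le> (\<Sum>i=1..n-1. (c (i + 1) - c i) * ?I (U i) (U n))
      + c 1 * ?I (U 0) (U n) + ?I F (U n)" using psd by linarith
  then have "h * (c n * ?I (U n) (U n)) \<le> h * ((\<Sum>i=1..n-1. (c (i + 1) - c i) * ?I (U i) (U n))
      + c 1 * ?I (U 0) (U n) + ?I F (U n))" using h by (rule mult_left_mono)
  also have "\<dots> = (\<Sum>i=1..n-1. (c (i + 1) - c i) * (h * ?I (U i) (U n)))
      + c 1 * (h * ?I (U 0) (U n)) + h * ?I F (U n)"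
    by (simp only: distrib_left sum_distrib_left[of h] mult.left_commute[of h])
  also have "\<dots> \<le> (\<Sum>i=1..n-1. (c (i + 1) - c i) * (?n (U i) * ?n (U n)))
      + c 1 * (?n (U 0) * ?n (U n)) + ?n F * ?n (U n)"
    using c1 mono hnorm_Cauchy_Schwarz[OF h]
    by (intro add_mono sum_mono mult_left_mono) auto
  also have "\<dots> = ((\<Sum>i=1..n-1. (c (i + 1) - c i) * ?n (U i)) + c 1 * ?n (U 0) + ?n F) * ?n (U n)"
    by (simp only: distrib_right sum_distrib_right mult.assoc)
  also have "h * (c n * ?I (U n) (U n)) = (c n * ?n (U n)) * ?n (U n)"
    using sq by (simp only: mult.left_commute[of h] mult.assoc)
  finally show ?thesis
    by (rule mult_right_le_imp_le) (use False hnorm_nonneg[OF h, of M "U n"] in simp)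
qed

text \<open>The weights of the past values are nonnegative and telescope to c_n - c_1; with c_1 for
  u_0 they sum to c_n. The past is thus an average bounded by induction, and the source fills the
  missing share c_1 G_n.\<close>

lemma discrete_stability:
  fixes c :: "nat \<Rightarrow> nat \<Rightarrow> real" and u \<phi> G :: "nat \<Rightarrow> real"
  assumes step: "\<And>n. 1 \<le> n \<Longrightarrow> n \<le> N \<Longrightarrow>
      c n n * u n \<le> (\<Sum>i=1..n-1. (c (i + 1) n - c i n) * u i) + c 1 n * u 0 + \<phi> n"
    and mono: "\<And>i n. 1 \<le> i \<Longrightarrow> i < n \<Longrightarrow> n \<le> N \<Longrightarrow> c i n \<le> c (i + 1) n"
    and pos: "\<And>n. 1 \<le> n \<Longrightarrow> n \<le> N \<Longrightarrow> 0 < c 1 n"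
    and source: "\<And>n. 1 \<le> n \<Longrightarrow> n \<le> N \<Longrightarrow> \<phi> n \<le> c 1 n * G n"
    and G_mono: "\<And>i n. 1 \<le> i \<Longrightarrow> i \<le> n \<Longrightarrow> n \<le> N \<Longrightarrow> G i \<le> G n"
  shows "1 \<le> n \<Longrightarrow> n \<le> N \<Longrightarrow> u n \<le> u 0 + G n"
proof (induction n rule: less_induct)
  case (less n)
  have tele: "(\<Sum>i=1..n-1. (c (i + 1) n - c i n)) = c n n - c 1 n"
    using sum_Suc_diff[of 1 "n - 1" "\<lambda>i. c i n"] less.prems by simp
  have "c 1 n \<le> c n n"
  proof -
    have "0 \<le> (\<Sum>i=1..n-1. (c (i + 1) n - c i n))" using mono less.prems by (intro sum_nonneg) auto
    then show ?thesis using tele by simp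
  qed
  then have cn: "0 < c n n" using pos less.prems by force
  have "c n n * u n \<le> (\<Sum>i=1..n-1. (c (i + 1) n - c i n) * u i) + c 1 n * u 0 + \<phi> n"
    using step less.prems by simp
  also have "\<dots> \<le> (\<Sum>i=1..n-1. (c (i + 1) n - c i n) * (u 0 + G n)) + c 1 n * u 0 + c 1 n * G n"
  proof (rule add_mono[OF add_mono[OF sum_mono[OF mult_left_mono] order.refl] source[OF less.prems]])
    fix i assume i: "i \<in> {1..n-1}"
    then have "u i \<le> u 0 + G i" using less by auto
    also have "G i \<le> G n" using i less.prems by (intro G_mono) auto
    finally show "u i \<le> u 0 + G n" by simp
    show "0 \<le> c (i + 1) n - c i n" using mono i less.prems by auto
  qed
  also have "\<dots> = c n n * (u 0 + G n)"
    unfolding sum_distrib_right[symmetric] tele by (simp add: algebra_simps)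
  finally show ?case using cn by simp
qed

theorem theorem4p1:
  fixes \<alpha> \<beta> a0 T a b :: real
  assumes "0 < \<alpha>" "\<alpha> < 0.3738" "1 < \<beta>" "\<beta> < 2"
    and "0 < a0" "a0 < T" "a < b"
  shows "\<exists>\<tau>0 > 0. \<exists>h0 > 0. \<forall>N M :: nat. \<forall>u0 f U.
     0 < N \<longrightarrow> 0 < M \<longrightarrow> (T - a0) / real N \<le> \<tau>0 \<longrightarrow> (b - a) / real M \<le> h0 \<longrightarrow>
     L12_scheme \<alpha> \<beta> a0 T N a b M u0 f U \<longrightarrow>
     (\<forall>n. 1 \<le> n \<and> n \<le> N \<longrightarrow>
        hnorm ((b - a) / real M) M (U n)
        \<le> hnorm ((b - a) / real M) M (U 0)
          + max (6 * Gamma (1 - \<alpha>) / a0 powr \<alpha>) (3 * Gamma (2 - \<alpha>) / (\<alpha> * a0 powr \<alpha>))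
            * Max ((\<lambda>k. (real k * ((T - a0) / real N)) powr \<alpha>
                     * hnorm ((b - a) / real M) M (\<lambda>j. f (a + real j * ((b - a) / real M))
                                                      (tgrid a0 T N k))) ` {1..n}))"
proof -
  obtain \<tau>0 where \<tau>0: "0 < \<tau>0"
    and mono: "\<And>N i k. 0 < N \<Longrightarrow> (T - a0) / real N \<le> \<tau>0 \<Longrightarrow> 1 \<le> i \<Longrightarrow> i < k
       \<Longrightarrow> L12_c \<alpha> (tgrid a0 T N) i k \<le> L12_c \<alpha> (tgrid a0 T N) (Suc i) k"
    and first: "\<And>N k. 0 < N \<Longrightarrow> (T - a0) / real N \<le> \<tau>0 \<Longrightarrow> 1 \<le> k
       \<Longrightarrow> 1 \<le> L12_c \<alpha> (tgrid a0 T N) 1 k * (6 * Gamma (1 - \<alpha>) / a0 powr \<alpha> * (real k * ((T - a0) / real N)) powr \<alpha>)"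
    using L12_c_mono_and_first_ge[OF assms(1,2,5,6)] by blast
  show ?thesis
  proof (rule exI[of _ \<tau>0], rule conjI[OF \<tau>0], rule exI[of _ 1], rule conjI[OF zero_less_one], intro allI impI)
    fix N M n :: nat and u0 f U
    assume N: "0 < N" and M: "0 < M" and tau: "(T - a0) / real N \<le> \<tau>0"
      and sch: "L12_scheme \<alpha> \<beta> a0 T N a b M u0 f U" and n: "1 \<le> n \<and> n \<le> N"
    define h where "h = (b - a) / real M"
    define \<tau> where "\<tau> = (T - a0) / real N"
    define t where "t = tgrid a0 T N"
    define c where "c = L12_c \<alpha> t"
    define C where "C = max (6 * Gamma (1 - \<alpha>) / a0 powr \<alpha>) (3 * Gamma (2 - \<alpha>) / (\<alpha> * a0 powr \<alpha>))"
    define F where "F = (\<lambda>k j. f (a + real j * h) (t k))"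
    define A where "A = (\<lambda>n j. h powr (-\<beta>) * (\<Sum>k = 0..M. riesz_r \<beta> (int j - int k) * U n k))"
    \<comment> \<open>A maximum over growing index sets is nondecreasing in n, as the induction
      requires.\<close>
    define G where "G = (\<lambda>n. C * Max ((\<lambda>k. (real k * \<tau>) powr \<alpha> * hnorm h M (F k)) ` {1..n}))"
    have h: "0 \<le> h" using assms M by (simp add: h_def)
    have bnd: "U n 0 = 0" "U n M = 0" if "1 \<le> n" "n \<le> N" for n
      using sch that unfolding L12_scheme_def Let_def by blast+
    have eq1: "\<forall>j. 1 \<le> j \<and> j \<le> M - 1 \<longrightarrow> c 1 1 * U 1 j - c 1 1 * U 0 j + A 1 j = F 1 j"
      and eq2: "\<forall>n j. 2 \<le> n \<and> n \<le> N \<and> 1 \<le> j \<and> j \<le> M - 1 \<longrightarrow>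
        c n n * U n j + (\<Sum>i=1..n-1. (c i n - c (i + 1) n) * U i j) - c 1 n * U 0 j + A n j = F n j"
      using sch unfolding L12_scheme_def Let_def c_def A_def F_def h_def t_def by blast+
    have eq: "c n n * U n j + (\<Sum>i=1..n-1. (c i n - c (i + 1) n) * U i j) - c 1 n * U 0 j + A n j = F n j"
      if "1 \<le> n" "n \<le> N" "1 \<le> j" "j \<le> M - 1" for n j
      using eq1 eq2 that by (cases "n = 1") auto
    have psd: "0 \<le> (\<Sum>j=1..M-1. A n j * U n j)" if "1 \<le> n" "n \<le> N" for n
    proof -
      have "0 \<le> h powr (-\<beta>) * (\<Sum>j=0..M. \<Sum>k=0..M. riesz_r \<beta> (int j - int k) * U n k * U n j)"
        using riesz_psd[OF assms(3,4)] by simp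
      also have "\<dots> = (\<Sum>j=0..M. A n j * U n j)"
        by (simp add: A_def sum_distrib_left sum_distrib_right mult.assoc)
      \<comment> \<open>The boundary values vanish for n \<ge> 1, so the interior sum is the full
        quadratic form.\<close>
      also have "\<dots> = (\<Sum>j=1..M-1. A n j * U n j)"
      proof (rule sum.mono_neutral_right)
        show "\<forall>j\<in>{0..M} - {1..M-1}. A n j * U n j = 0"
        proof
          fix j assume "j \<in> {0..M} - {1..M-1}"
          then have "j = 0 \<or> j = M" by auto
          then show "A n j * U n j = 0" using bnd[OF that] by auto
        qed
      qed auto
      finally show ?thesis .
    qed
    have Cpos: "0 < 6 * Gamma (1 - \<alpha>) / a0 powr \<alpha>"
      using assms by (intro divide_pos_pos mult_pos_pos Gamma_real_pos) auto
    then have C: "0 \<le> C" "6 * Gamma (1 - \<alpha>) / a0 powr \<alpha> \<le> C" unfolding C_def by linarith+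
    \<comment> \<open>The product of \<open>c 1 n\<close> with a nonnegative factor is at least 1,
      which forces positivity.\<close>
    have cpos: "0 < c 1 n" if "1 \<le> n" for n
    proof (rule ccontr)
      assume "\<not> 0 < c 1 n"
      then have "c 1 n * (6 * Gamma (1 - \<alpha>) / a0 powr \<alpha> * (real n * \<tau>) powr \<alpha>) \<le> 0"
        using Cpos by (intro mult_nonpos_nonneg mult_nonneg_nonneg) auto
      then show False using first[OF N tau that] by (simp add: c_def t_def \<tau>_def)
    qed
    have cmono: "c i n \<le> c (i + 1) n" if "1 \<le> i" "i < n" for i n
      using mono[OF N tau that] by (simp add: c_def t_def)
    have cC: "1 \<le> c 1 n * (C * (real n * \<tau>) powr \<alpha>)" if "1 \<le> n" for n
    proof -
      have "1 \<le> c 1 n * (6 * Gamma (1 - \<alpha>) / a0 powr \<alpha> * (real n * \<tau>) powr \<alpha>)"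
        using first[OF N tau that] by (simp add: c_def t_def \<tau>_def)
      also have "\<dots> \<le> c 1 n * (C * (real n * \<tau>) powr \<alpha>)"
        using C cpos[OF that] by (intro mult_left_mono mult_right_mono) auto
      finally show ?thesis .
    qed
    have "hnorm h M (U n) \<le> hnorm h M (U 0) + G n"
    proof (rule discrete_stability[where N = N and c = c and \<phi> = "\<lambda>n. hnorm h M (F n)"])
      fix n assume n: "1 \<le> n" "n \<le> N"
      show "c n n * hnorm h M (U n) \<le> (\<Sum>i=1..n-1. (c (i + 1) n - c i n) * hnorm h M (U i))
          + c 1 n * hnorm h M (U 0) + hnorm h M (F n)"
        by (rule energy_step[OF h, where A = "A n"])
          (use eq n psd cmono cpos[OF n(1)] in \<open>auto simp: less_imp_le\<close>)
      have "1 * hnorm h M (F n) \<le> (c 1 n * (C * (real n * \<tau>) powr \<alpha>)) * hnorm h M (F n)"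
        using cC[OF n(1)] hnorm_nonneg[OF h] by (rule mult_right_mono)
      also have "\<dots> = (c 1 n * C) * ((real n * \<tau>) powr \<alpha> * hnorm h M (F n))" by simp
      also have "\<dots> \<le> (c 1 n * C) * Max ((\<lambda>k. (real k * \<tau>) powr \<alpha> * hnorm h M (F k)) ` {1..n})"
        using C cpos[OF n(1)] n by (intro mult_left_mono Max_ge) auto
      finally show "hnorm h M (F n) \<le> c 1 n * G n" by (simp add: G_def)
    next
      fix i n assume "1 \<le> i" "i \<le> (n::nat)" "n \<le> N"
      then show "G i \<le> G n" unfolding G_def using C
        by (intro mult_left_mono Max_mono image_mono) auto
    qed (use n cpos cmono in auto)
    then show "hnorm ((b - a) / real M) M (U n)
        \<le> hnorm ((b - a) / real M) M (U 0)
          + max (6 * Gamma (1 - \<alpha>) / a0 powr \<alpha>) (3 * Gamma (2 - \<alpha>) / (\<alpha> * a0 powr \<alpha>))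
            * Max ((\<lambda>k. (real k * ((T - a0) / real N)) powr \<alpha>
                     * hnorm ((b - a) / real M) M (\<lambda>j. f (a + real j * ((b - a) / real M))
                                                      (tgrid a0 T N k))) ` {1..n})"
      unfolding G_def C_def F_def \<tau>_def h_def t_def .
  qed
qed

end
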